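(* Let $(K,w)$ be an oriented weighted simplicial complex, let $0\le i\le \dim K$, and suppose that the Hodge Laplacian $\mathcal{L}_i$ is bounded on $\ell^2_w=\ell^2(S_i(K),w)$. Let $\rho$ be an intrinsic metric on $S_i(K)$ with jump size $s\in(0,\infty)$, and let $\lambda$ be the bottom of the $\ell^2$-spectrum of $\mathcal{L}_i$. Then for all $F,F'\in S_i(K)$ and all $t>0$ the heat kernel $p_t$ of $\mathcal{L}_i$ satisfies $$|p_t(F,F')|\le\frac{1}{\sqrt{w(F)w(F')}}\,e^{-\lambda t-\zeta_s(t,\rho(F,F'))},$$ where $\zeta_s(t,r)=\frac{1}{s^2}\left(rs\,\operatorname{arcsinh}\frac{rs}{t}-\sqrt{t^2+r^2s^2}+t\right)$.
   Context: Simplicial complexes. An abstract simplicial complex $K$ on a vertex set $V$ (possibly infinite) is a collection of finite subsets of $V$ closed under inclusion. An $i$-face is an element of $K$ of cardinality $i+1$; $S_i(K)$ is the set of $i$-faces, and $S_{-1}(K)=\{\emptyset\}$. $\dim K$ is the largest dimension of a face. $K$ is weighted by a function $w:\bigcup_{i=-1}^{\dim K}S_i(K)\to(0,\infty)$. $K$ is oriented: every face has a chosen orientation (ordering of its vertices up to even permutations). For an $i$-face $F$, $\partial F$ denotes the set of its $(i-1)$-faces. For $F\in\partial\overline F$, $\sigma_{F\overline F}=\pm1$ is the sign of the oriented face $[F]$ in the boundary $\partial[v_0,\dots,v_{i+1}]=\sum_k(-1)^k[v_0,\dots,\widehat{v_k},\dots,v_{i+1}]$ of $[\overline F]$; $\sigma_{F\overline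 F}=0$ if $F\notin\partial\overline F$. Hodge Laplacian. Real $i$-cochains are identified with functions $f:S_i(K)\to\mathbb{R}$ via the chosen orientations. The inner product is $\langle f,g\rangle=\sum_{F\in S_i(K)}f(F)g(F)w(F)$, and $\ell^2_w=\ell^2(S_i(K),w)$ is the corresponding Hilbert space. The coboundary operator is $(\delta_if)(\overline F)=\sum_{F\in\partial\overline F}\sigma_{F\overline F}f(F)$, $\delta_i^*$ is its adjoint, and $\mathcal{L}_i=\delta_i^*\delta_i+\delta_{i-1}\delta_{i-1}^*$. "$\mathcal{L}_i$ is bounded" means that $\delta_i$ and $\delta_{i-1}$ are bounded operators between the corresponding $\ell^2_w$ spaces, so $\mathcal{L}_i$ is a bounded non-negative self-adjoint operator on $\ell^2_w$ and $e^{-t\mathcal{L}_i}$, $t\ge0$, is defined. The heat kernel is $p_t(F,F')=\big(e^{-t\mathcal{L}_i}\tfrac{1}{w(F')}\delta_{F'}\big)(F)$, where $\delta_{F'}$ is the function equal to $1$ at $F'$ and $0$ elsewhere. Intrinsic metrics. For distinct $i$-faces $F,F'$ set $w^{up}_{FF'}=w(\overline F)$ if there is an $(i+1)$-face $\overline F\in K$ with $F,F'\in\partial\overline F$ (then $\overline F=F\cup F'$ is unique) and $0$ otherwise; $w^{down}_{FF'}=\frac{w(F)w(F')}{w(E)}$ if $E=F\cap F'$ is an $(i-1)$-face and $0$ otherwise; $w_{FF'}=w^{up}_{FF'}+w^{down}_{FF'}$; and $w_{FF}=0$. Write $F\sim F'$ if $w_{FF'}\ne0$. A pseudo metric $\rho$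 on $S_i(K)$ (the value $\infty$ is allowed) is intrinsic if $\sum_{F'\in S_i(K)}w_{FF'}\rho^2(F,F')\le w(F)$ for all $F\in S_i(K)$. Its jump size is $s=\sup\{\rho(F,F'):F,F'\in S_i(K),\ F\sim F'\}$ (with $s=\infty$ if there is no pair $F\sim F'$). If $\rho(F,F')=\infty$, then $\zeta_s(t,\infty)=\infty$ and $e^{-\infty}=0$. *)

theory Defs
  imports "HOL-Analysis.Analysis" "HOL-Combinatorics.Combinatorics"
begin

definition abstract_complex :: "'a set \<Rightarrow> 'a set set \<Rightarrow> bool" where
  "abstract_complex V K \<longleftrightarrow>
     (\<forall>F\<in>K. finite F \<and> F \<subseteq> V) \<and> (\<forall>F\<in>K. \<forall>E. E \<subseteq> F \<longrightarrow> E \<in> K)"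

text \<open>Dimensions are integers, so that the empty face has dimension \<open>-1\<close>.\<close>

definition faces :: "'a set set \<Rightarrow> int \<Rightarrow> 'a set set" where
  "faces K i = {F \<in> K. int (card F) = i + 1}"

text \<open>The supremum is \<open>\<infinity>\<close> if the complex has faces of arbitrarily large dimension.\<close>

definition dim_of_complex :: "'a set set \<Rightarrow> ereal" where
  "dim_of_complex K = (SUP F\<in>K. ereal (real (card F) - 1))"

definition weighted_complex :: "'a set set \<Rightarrow> ('a set \<Rightarrow> real) \<Rightarrow> bool" where
  "weighted_complex K w \<longleftrightarrow> (\<forall>F\<in>K. 0 < w F)"

definition even_reordering :: "'a set \<Rightarrow> ('a list \<times> 'a list) set" where
  "even_reordering F = {(xs, ys). xs \<in> permutations_of_set F \<and> ys \<in> permutations_of_set F \<and>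
     (\<exists>p. p permutes {..<length xs} \<and> evenperm p \<and> ys = permute_list p xs)}"

text \<open>An orientation of a face is a class of orderings of its vertices modulo even permutations.\<close>

definition oriented_complex :: "'a set set \<Rightarrow> ('a set \<Rightarrow> 'a list set) \<Rightarrow> bool" where
  "oriented_complex K ori \<longleftrightarrow> (\<forall>F\<in>K. ori F \<in> permutations_of_set F // even_reordering F)"

definition bdry :: "'a set set \<Rightarrow> 'a set \<Rightarrow> 'a set set" where
  "bdry K G = {F \<in> K. F \<subseteq> G \<and> card G = card F + 1}"

text \<open>The sign of \<open>[F]\<close> in \<open>\<partial>[v\<^sub>0,\<dots>,v\<^sub>n] = (\<Sum>k. (-1)\<^sup>k [v\<^sub>0,\<dots>,v\<^sub>k omitted,\<dots>,v\<^sub>n])\<close>, where \<open>vs\<close>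
  is any ordering in the orientation of \<open>G\<close> (the sign does not depend on which one) and
  \<open>k\<close> is the position of the vertex of \<open>G\<close> missing in \<open>F\<close>.\<close>

definition incidence ::
  "'a set set \<Rightarrow> ('a set \<Rightarrow> 'a list set) \<Rightarrow> 'a set \<Rightarrow> 'a set \<Rightarrow> real" where
  "incidence K ori F G =
     (if F \<in> bdry K G then
        (let vs = (SOME vs. vs \<in> ori G);
             k = (THE k. k < length vs \<and> F = G - {vs ! k})
         in (-1) ^ k * (if take k vs @ drop (Suc k) vs \<in> ori F then 1 else -1))
      else 0)"

text \<open>Cochains on \<open>faces K i\<close> are represented by functions that vanish on all other sets.\<close>

definition l2 :: "'a set set \<Rightarrow> ('a set \<Rightarrow> real) \<Rightarrow> int \<Rightarrow> ('a set \<Rightarrow> real) set" where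
  "l2 K w i = {f. (\<forall>F. F \<notin> faces K i \<longrightarrow> f F = 0) \<and>
                  (\<lambda>F. (f F)\<^sup>2 * w F) summable_on faces K i}"

definition l2_inner ::
  "'a set set \<Rightarrow> ('a set \<Rightarrow> real) \<Rightarrow> int \<Rightarrow> ('a set \<Rightarrow> real) \<Rightarrow> ('a set \<Rightarrow> real) \<Rightarrow> real" where
  "l2_inner K w i f g = (\<Sum>\<^sub>\<infinity>F\<in>faces K i. f F * g F * w F)"

definition l2_norm :: "'a set set \<Rightarrow> ('a set \<Rightarrow> real) \<Rightarrow> int \<Rightarrow> ('a set \<Rightarrow> real) \<Rightarrow> real" where
  "l2_norm K w i f = sqrt (l2_inner K w i f f)"

definition l2_bounded_op ::
  "'a set set \<Rightarrow> ('a set \<Rightarrow> real) \<Rightarrow> int \<Rightarrow> int \<Rightarrow>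
    (('a set \<Rightarrow> real) \<Rightarrow> 'a set \<Rightarrow> real) \<Rightarrow> bool" where
  "l2_bounded_op K w i j T \<longleftrightarrow>
     (\<forall>f\<in>l2 K w i. T f \<in> l2 K w j) \<and>
     (\<forall>f\<in>l2 K w i. \<forall>g\<in>l2 K w i. \<forall>a b.
        T (\<lambda>F. a * f F + b * g F) = (\<lambda>F. a * T f F + b * T g F)) \<and>
     (\<exists>C. \<forall>f\<in>l2 K w i. l2_norm K w j (T f) \<le> C * l2_norm K w i f)"

definition l2_adjoint ::
  "'a set set \<Rightarrow> ('a set \<Rightarrow> real) \<Rightarrow> int \<Rightarrow> int \<Rightarrow>
    (('a set \<Rightarrow> real) \<Rightarrow> 'a set \<Rightarrow> real) \<Rightarrow> ('a set \<Rightarrow> real) \<Rightarrow> 'a set \<Rightarrow> real" where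
  "l2_adjoint K w i j T g =
     (THE h. h \<in> l2 K w i \<and> (\<forall>f\<in>l2 K w i. l2_inner K w j (T f) g = l2_inner K w i f h))"

text \<open>The limit of the exponential series of \<open>T\<close> applied to \<open>f\<close>, in the norm of \<open>l2 K w i\<close>.\<close>

definition l2_exp ::
  "'a set set \<Rightarrow> ('a set \<Rightarrow> real) \<Rightarrow> int \<Rightarrow>
    (('a set \<Rightarrow> real) \<Rightarrow> 'a set \<Rightarrow> real) \<Rightarrow> ('a set \<Rightarrow> real) \<Rightarrow> 'a set \<Rightarrow> real" where
  "l2_exp K w i T f =
     (THE g. g \<in> l2 K w i \<and>
        (\<lambda>n. l2_norm K w i (\<lambda>F. (\<Sum>k<n. (T ^^ k) f F / fact k) - g F)) \<longlonglongrightarrow> 0)"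

text \<open>Real spectral values suffice: the operators of interest are self-adjoint.\<close>

definition l2_spectrum ::
  "'a set set \<Rightarrow> ('a set \<Rightarrow> real) \<Rightarrow> int \<Rightarrow>
    (('a set \<Rightarrow> real) \<Rightarrow> 'a set \<Rightarrow> real) \<Rightarrow> real set" where
  "l2_spectrum K w i T =
     {\<mu>. \<not> (\<exists>R. l2_bounded_op K w i i R \<and>
               (\<forall>f\<in>l2 K w i. R (\<lambda>F. T f F - \<mu> * f F) = f \<and>
                             (\<lambda>F. T (R f) F - \<mu> * R f F) = f))}"

definition coboundary ::
  "'a set set \<Rightarrow> ('a set \<Rightarrow> 'a list set) \<Rightarrow> int \<Rightarrow> ('a set \<Rightarrow> real) \<Rightarrow> 'a set \<Rightarrow> real" where
  "coboundary K ori i f G =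
     (if G \<in> faces K (i + 1) then \<Sum>F\<in>bdry K G. incidence K ori F G * f F else 0)"

definition hodge_laplacian ::
  "'a set set \<Rightarrow> ('a set \<Rightarrow> real) \<Rightarrow> ('a set \<Rightarrow> 'a list set) \<Rightarrow> int \<Rightarrow>
    ('a set \<Rightarrow> real) \<Rightarrow> 'a set \<Rightarrow> real" where
  "hodge_laplacian K w ori i f F =
     l2_adjoint K w i (i + 1) (coboundary K ori i) (coboundary K ori i f) F +
     coboundary K ori (i - 1) (l2_adjoint K w (i - 1) i (coboundary K ori (i - 1)) f) F"

definition hodge_laplacian_bounded ::
  "'a set set \<Rightarrow> ('a set \<Rightarrow> real) \<Rightarrow> ('a set \<Rightarrow> 'a list set) \<Rightarrow> int \<Rightarrow> bool" where
  "hodge_laplacian_bounded K w ori i \<longleftrightarrow>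
     l2_bounded_op K w i (i + 1) (coboundary K ori i) \<and>
     l2_bounded_op K w (i - 1) i (coboundary K ori (i - 1))"

definition spectral_bottom ::
  "'a set set \<Rightarrow> ('a set \<Rightarrow> real) \<Rightarrow> ('a set \<Rightarrow> 'a list set) \<Rightarrow> int \<Rightarrow> real" where
  "spectral_bottom K w ori i = Inf (l2_spectrum K w i (hodge_laplacian K w ori i))"

definition heat_kernel ::
  "'a set set \<Rightarrow> ('a set \<Rightarrow> real) \<Rightarrow> ('a set \<Rightarrow> 'a list set) \<Rightarrow> int \<Rightarrow>
    real \<Rightarrow> 'a set \<Rightarrow> 'a set \<Rightarrow> real" where
  "heat_kernel K w ori i t F F' =
     l2_exp K w i (\<lambda>f E. - t * hodge_laplacian K w ori i f E)
       (\<lambda>E. 1 / w F' * (if E = F' then 1 else 0)) F"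

definition w_up :: "'a set set \<Rightarrow> ('a set \<Rightarrow> real) \<Rightarrow> int \<Rightarrow> 'a set \<Rightarrow> 'a set \<Rightarrow> real" where
  "w_up K w i F F' =
     (if \<exists>G\<in>faces K (i + 1). F \<in> bdry K G \<and> F' \<in> bdry K G then w (F \<union> F') else 0)"

definition w_down :: "'a set set \<Rightarrow> ('a set \<Rightarrow> real) \<Rightarrow> int \<Rightarrow> 'a set \<Rightarrow> 'a set \<Rightarrow> real" where
  "w_down K w i F F' =
     (if F \<inter> F' \<in> faces K (i - 1) then w F * w F' / w (F \<inter> F') else 0)"

definition w_pair :: "'a set set \<Rightarrow> ('a set \<Rightarrow> real) \<Rightarrow> int \<Rightarrow> 'a set \<Rightarrow> 'a set \<Rightarrow> real" where
  "w_pair K w i F F' = (if F = F' then 0 else w_up K w i F F' + w_down K w i F F')"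

definition pseudo_metric_on :: "'b set \<Rightarrow> ('b \<Rightarrow> 'b \<Rightarrow> ennreal) \<Rightarrow> bool" where
  "pseudo_metric_on X \<rho> \<longleftrightarrow>
     (\<forall>x\<in>X. \<rho> x x = 0) \<and> (\<forall>x\<in>X. \<forall>y\<in>X. \<rho> x y = \<rho> y x) \<and>
     (\<forall>x\<in>X. \<forall>y\<in>X. \<forall>z\<in>X. \<rho> x z \<le> \<rho> x y + \<rho> y z)"

text \<open>In \<^typ>\<open>ennreal\<close>, \<open>0 * \<infinity> = 0\<close>, so infinite distances are only constrained on adjacent faces.\<close>

definition intrinsic_metric ::
  "'a set set \<Rightarrow> ('a set \<Rightarrow> real) \<Rightarrow> int \<Rightarrow> ('a set \<Rightarrow> 'a set \<Rightarrow> ennreal) \<Rightarrow> bool" where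
  "intrinsic_metric K w i \<rho> \<longleftrightarrow> pseudo_metric_on (faces K i) \<rho> \<and>
     (\<forall>F\<in>faces K i. (\<Sum>\<^sub>\<infinity>F'\<in>faces K i. ennreal (w_pair K w i F F') * (\<rho> F F')\<^sup>2) \<le> ennreal (w F))"

definition adjacent_pairs ::
  "'a set set \<Rightarrow> ('a set \<Rightarrow> real) \<Rightarrow> int \<Rightarrow> ('a set \<times> 'a set) set" where
  "adjacent_pairs K w i =
     {(F, F'). F \<in> faces K i \<and> F' \<in> faces K i \<and> w_pair K w i F F' \<noteq> 0}"

definition jump_size ::
  "'a set set \<Rightarrow> ('a set \<Rightarrow> real) \<Rightarrow> int \<Rightarrow> ('a set \<Rightarrow> 'a set \<Rightarrow> ennreal) \<Rightarrow> ennreal" where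
  "jump_size K w i \<rho> =
     (if adjacent_pairs K w i = {} then \<infinity> else SUP (F, F')\<in>adjacent_pairs K w i. \<rho> F F')"

definition zeta_real :: "real \<Rightarrow> real \<Rightarrow> real \<Rightarrow> real" where
  "zeta_real s t r =
     1 / s\<^sup>2 * (r * s * arsinh (r * s / t) - sqrt (t\<^sup>2 + r\<^sup>2 * s\<^sup>2) + t)"

definition zeta :: "real \<Rightarrow> real \<Rightarrow> ennreal \<Rightarrow> ereal" where
  "zeta s t r = (if r = \<infinity> then \<infinity> else ereal (zeta_real s t (enn2real r)))"

definition exp_ereal :: "ereal \<Rightarrow> ereal" where
  "exp_ereal x =
     (if x = \<infinity> then \<infinity> else if x = -\<infinity> then 0 else ereal (exp (real_of_ereal x)))"

end

(* A bounded twist e^psi changes the quadratic form of the Laplacian only through the terms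
   cosh (psi F - psi F') - 1 in front of its off-diagonal entries, since the entries are symmetric.
   These entries are dominated by w_pair, so for psi = theta * rho(F', -), truncated at a real number
   below rho(F', F), the intrinsic bound on sum w_pair rho^2 and convexity give
   <L e^-psi g, e^psi g> >= (lambda - (cosh (theta s) - 1) / s^2) |g|^2.  Hence the twisted semigroup
   decays at that rate (Davies' method), and reading off one entry and optimising over theta gives
   zeta_s as a Legendre transform.  Truncation keeps the twist bounded, so that the differential
   inequality makes sense, and also covers infinite distances.  That the form of L is bounded below by
   the bottom of the spectrum follows because the infimum of its numerical range is spectral. *)

theory Submission
  imports Defs "HOL-Real_Asymp.Real_Asymp"
begin

section \<open>The Hilbert space of square-summable families\<close>

text \<open>\<open>l2_adjoint\<close>, \<open>l2_exp\<close> and \<open>l2_spectrum\<close> speak of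
  functions in a set, where limits, derivatives and inverses are awkward. Multiplication by
  \<open>sqrt w\<close> carries the cochains of every degree isometrically into one Hilbert space,
  indexed by all sets of vertices, whose bounded operators form a Banach algebra with its own
  \<open>exp\<close>. The price is the orthogonal complement of the i-cochains: the Laplacian is 0
  there, so a positive lower bound of its form would fail, and the operator has to be altered on
  that complement. The rescaling also divides the entry at F, F' by
  \<open>sqrt (w F) * sqrt (w F')\<close>, while the intrinsic condition is normalised by
  \<open>w F\<close> alone. A Schur test with weights \<open>sqrt w\<close> reconciles the two. The
  constant (cosh (\<theta> s) - 1) / s^2 arises because (cosh (\<theta> d) - 1) / d^2 grows with d,
  and adjacent faces have distance d at most s. Diagonal entries are never computed: the twist
  leaves them alone, and they enter only through the spectral lower bound.\<close>

typedef 'b ell2 = "{f :: 'b \<Rightarrow> real. (\<lambda>x. (f x)\<^sup>2) summable_on UNIV}"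
  morphisms coord Abs_ell2
  by (rule exI[of _ "\<lambda>_. 0"]) simp

setup_lifting type_definition_ell2

lemma summable_on_mult_squares:
  fixes f g :: "'b \<Rightarrow> real"
  assumes "(\<lambda>x. (f x)\<^sup>2) summable_on A" and "(\<lambda>x. (g x)\<^sup>2) summable_on A"
  shows "(\<lambda>x. f x * g x) summable_on A"
proof -
  have "(\<lambda>x. norm ((f x)\<^sup>2 + (g x)\<^sup>2)) summable_on A"
    using summable_on_add[OF assms] by simp
  then have "(\<lambda>x. norm (f x * g x)) summable_on A"
  proof (rule Infinite_Sum.abs_summable_on_comparison_test)
    fix x
    have "2 * \<bar>f x\<bar> * \<bar>g x\<bar> \<le> (f x)\<^sup>2 + (g x)\<^sup>2"
      using sum_squares_bound[of "\<bar>f x\<bar>" "\<bar>g x\<bar>"] by simp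
    moreover have "0 \<le> \<bar>f x\<bar> * \<bar>g x\<bar>" by simp
    ultimately have "\<bar>f x\<bar> * \<bar>g x\<bar> \<le> (f x)\<^sup>2 + (g x)\<^sup>2" by linarith
    then show "norm (f x * g x) \<le> norm ((f x)\<^sup>2 + (g x)\<^sup>2)"
      by (simp add: abs_mult)
  qed
  then show ?thesis by (rule Infinite_Sum.abs_summable_summable)
qed

lemma square_summable_add:
  fixes f g :: "'b \<Rightarrow> real"
  assumes "(\<lambda>x. (f x)\<^sup>2) summable_on A" and "(\<lambda>x. (g x)\<^sup>2) summable_on A"
  shows "(\<lambda>x. (f x + g x)\<^sup>2) summable_on A"
proof -
  have "(\<lambda>x. (f x)\<^sup>2 + (g x)\<^sup>2 + 2 * (f x * g x)) summable_on A"
    by (intro summable_on_add assms summable_on_cmult_right summable_on_mult_squares)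
  then show ?thesis by (simp add: power2_sum mult.assoc)
qed

lemma square_summable_scale:
  fixes f :: "'b \<Rightarrow> real"
  assumes "(\<lambda>x. (f x)\<^sup>2) summable_on A"
  shows "(\<lambda>x. (c * f x)\<^sup>2) summable_on A"
  using summable_on_cmult_right[OF assms, of "c\<^sup>2"] by (simp add: power_mult_distrib)

instantiation ell2 :: (type) real_inner
begin

lift_definition zero_ell2 :: "'a ell2" is "\<lambda>_. 0" by simp

lift_definition plus_ell2 :: "'a ell2 \<Rightarrow> 'a ell2 \<Rightarrow> 'a ell2" is "\<lambda>f g x. f x + g x"
  by (rule square_summable_add)

lift_definition scaleR_ell2 :: "real \<Rightarrow> 'a ell2 \<Rightarrow> 'a ell2" is "\<lambda>c f x. c * f x"
  by (rule square_summable_scale)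

lift_definition uminus_ell2 :: "'a ell2 \<Rightarrow> 'a ell2" is "\<lambda>f x. - f x" by simp

lift_definition minus_ell2 :: "'a ell2 \<Rightarrow> 'a ell2 \<Rightarrow> 'a ell2" is "\<lambda>f g x. f x - g x"
  using square_summable_add square_summable_scale[where c = "-1"] by fastforce

lift_definition inner_ell2 :: "'a ell2 \<Rightarrow> 'a ell2 \<Rightarrow> real" is "\<lambda>f g. \<Sum>\<^sub>\<infinity>x. f x * g x" .

definition norm_ell2 :: "'a ell2 \<Rightarrow> real" where "norm_ell2 f = sqrt (f \<bullet> f)"

definition dist_ell2 :: "'a ell2 \<Rightarrow> 'a ell2 \<Rightarrow> real" where "dist_ell2 f g = norm (f - g)"

definition sgn_ell2 :: "'a ell2 \<Rightarrow> 'a ell2" where "sgn_ell2 f = inverse (norm f) *\<^sub>R f"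

definition uniformity_ell2 :: "('a ell2 \<times> 'a ell2) filter" where
  "uniformity_ell2 = (INF e\<in>{0 <..}. principal {(x, y). dist x y < e})"

definition open_ell2 :: "'a ell2 set \<Rightarrow> bool" where
  "open_ell2 S = (\<forall>x\<in>S. \<forall>\<^sub>F (x', y) in uniformity. x' = x \<longrightarrow> y \<in> S)"

instance
proof
  fix x y z :: "'a ell2" and a b r :: real
  show "x + y + z = x + (y + z)" "x + y = y + x" "0 + x = x" "- x + x = 0" "x - y = x + - y"
    "a *\<^sub>R (x + y) = a *\<^sub>R x + a *\<^sub>R y" "(a + b) *\<^sub>R x = a *\<^sub>R x + b *\<^sub>R x"
    "a *\<^sub>R b *\<^sub>R x = (a * b) *\<^sub>R x" "1 *\<^sub>R x = x"
    by (transfer; auto simp: algebra_simps)+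
  show "x \<bullet> y = y \<bullet> x"
    by transfer (simp add: mult.commute)
  show "(x + y) \<bullet> z = x \<bullet> z + y \<bullet> z"
  proof transfer
    fix f g h :: "'a \<Rightarrow> real"
    assume "(\<lambda>x. (f x)\<^sup>2) summable_on UNIV" "(\<lambda>x. (g x)\<^sup>2) summable_on UNIV"
      "(\<lambda>x. (h x)\<^sup>2) summable_on UNIV"
    then show "(\<Sum>\<^sub>\<infinity>x. (f x + g x) * h x) = (\<Sum>\<^sub>\<infinity>x. f x * h x) + (\<Sum>\<^sub>\<infinity>x. g x * h x)"
      by (subst infsum_add[symmetric]) (auto intro: summable_on_mult_squares simp: distrib_right)
  qed
  show "(r *\<^sub>R x) \<bullet> y = r * (x \<bullet> y)"
    by transfer (simp only: infsum_cmult_right' mult.assoc)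
  show "0 \<le> x \<bullet> x"
    by transfer (auto intro: infsum_nonneg)
  show "x \<bullet> x = 0 \<longleftrightarrow> x = 0"
  proof transfer
    fix f :: "'a \<Rightarrow> real"
    assume f: "(\<lambda>x. (f x)\<^sup>2) summable_on UNIV"
    have "f x = 0" if "(\<Sum>\<^sub>\<infinity>x. f x * f x) = 0" for x
      using nonneg_infsum_le_0D[of "\<lambda>x. (f x)\<^sup>2" UNIV x] f that by (simp add: power2_eq_square)
    then have "f = (\<lambda>_. 0)" if "(\<Sum>\<^sub>\<infinity>x. f x * f x) = 0"
      using that by blast
    moreover have "(\<Sum>\<^sub>\<infinity>x. f x * f x) = 0" if "f = (\<lambda>_. 0)"
      using that by simp
    ultimately show "((\<Sum>\<^sub>\<infinity>x. f x * f x) = 0) = (f = (\<lambda>_. 0))"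
      by blast
  qed
qed (simp_all add: norm_ell2_def dist_ell2_def sgn_ell2_def uniformity_ell2_def open_ell2_def)

end

lemma coord_simps [simp]:
  "coord 0 x = 0" "coord (f + g) x = coord f x + coord g x" "coord (f - g) x = coord f x - coord g x"
  "coord (- f) x = - coord f x" "coord (c *\<^sub>R f) x = c * coord f x"
  by (transfer; simp)+

lemma ell2_eqI: "(\<And>x. coord f x = coord g x) \<Longrightarrow> f = g"
  using coord_inject by blast

lemma square_summable_coord: "(\<lambda>x. (coord f x)\<^sup>2) summable_on A"
proof -
  have "(\<lambda>x. (coord f x)\<^sup>2) summable_on UNIV" by transfer
  then show ?thesis by (rule summable_on_subset_banach) simp
qed

lemma norm_ell2_square: "(norm f)\<^sup>2 = (\<Sum>\<^sub>\<infinity>x. (coord f x)\<^sup>2)"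
  unfolding power2_norm_eq_inner by transfer (simp add: power2_eq_square)

lemma sum_coord_square_le: "finite A \<Longrightarrow> (\<Sum>x\<in>A. (coord f x)\<^sup>2) \<le> (norm f)\<^sup>2"
  unfolding norm_ell2_square by (rule finite_sum_le_infsum) (auto intro: square_summable_coord)

lemma abs_coord_le_norm: "\<bar>coord f x\<bar> \<le> norm f"
  using sum_coord_square_le[of "{x}" f] abs_le_square_iff[of "coord f x" "norm f"] by simp

text \<open>Nonnegative terms with bounded finite sums are summable. This is how new vectors are
  built: limits of Cauchy sequences, Riesz vectors and images under multipliers.\<close>

lemma ell2_of_bounded_partial_sums:
  fixes f :: "'b \<Rightarrow> real"
  assumes le: "\<And>A. finite A \<Longrightarrow> (\<Sum>x\<in>A. (f x)\<^sup>2) \<le> c\<^sup>2" and c: "0 \<le> c"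
  shows "coord (Abs_ell2 f) = f" and "norm (Abs_ell2 f) \<le> c"
proof -
  have s: "(\<lambda>x. (f x)\<^sup>2) summable_on UNIV"
    by (rule nonneg_bdd_above_summable_on) (auto intro!: bdd_aboveI2 le)
  then show *: "coord (Abs_ell2 f) = f" by (simp add: Abs_ell2_inverse)
  have "(norm (Abs_ell2 f))\<^sup>2 \<le> c\<^sup>2"
    unfolding norm_ell2_square * by (rule infsum_le_finite_sums) (auto intro: s le)
  then show "norm (Abs_ell2 f) \<le> c" using c by (rule power2_le_imp_le)
qed

instance ell2 :: (type) banach
proof
  fix X :: "nat \<Rightarrow> 'a ell2"
  assume X: "Cauchy X"
  have "convergent (\<lambda>n. coord (X n) x)" for x
  proof (rule Cauchy_convergent, rule metric_CauchyI)
    fix e :: real assume "0 < e"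
    then obtain N where "\<And>m n. m \<ge> N \<Longrightarrow> n \<ge> N \<Longrightarrow> norm (X m - X n) < e"
      using X unfolding Cauchy_def dist_norm by blast
    then show "\<exists>N. \<forall>m\<ge>N. \<forall>n\<ge>N. dist (coord (X m) x) (coord (X n) x) < e"
      unfolding dist_norm real_norm_def
      by (metis abs_coord_le_norm coord_simps(3) order_le_less_trans)
  qed
  then obtain f where f: "\<And>x. (\<lambda>n. coord (X n) x) \<longlonglongrightarrow> f x"
    unfolding convergent_def by metis
  \<comment> \<open>For a fixed finite set \<open>A\<close> the Cauchy bound survives the limit in
    the second index, and the resulting bound does not depend on \<open>A\<close>.\<close>
  have tail: "\<exists>N. \<forall>n\<ge>N. \<forall>A. finite A \<longrightarrow> (\<Sum>x\<in>A. (coord (X n) x - f x)\<^sup>2) \<le> e\<^sup>2" if "0 < e" for e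
  proof -
    obtain N where N: "\<And>m n. m \<ge> N \<Longrightarrow> n \<ge> N \<Longrightarrow> norm (X m - X n) < e"
      using X \<open>0 < e\<close> unfolding Cauchy_def dist_norm by blast
    have "(\<Sum>x\<in>A. (coord (X n) x - f x)\<^sup>2) \<le> e\<^sup>2" if "n \<ge> N" "finite A" for n A
    proof (rule LIMSEQ_le_const2)
      show "(\<lambda>m. \<Sum>x\<in>A. (coord (X n) x - coord (X m) x)\<^sup>2) \<longlonglongrightarrow> (\<Sum>x\<in>A. (coord (X n) x - f x)\<^sup>2)"
        by (intro tendsto_intros f)
      have "(\<Sum>x\<in>A. (coord (X n) x - coord (X m) x)\<^sup>2) \<le> e\<^sup>2" if "m \<ge> N" for m
      proof -
        have "(\<Sum>x\<in>A. (coord (X n) x - coord (X m) x)\<^sup>2) \<le> (norm (X n - X m))\<^sup>2"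
          using sum_coord_square_le[OF \<open>finite A\<close>, of "X n - X m"] by simp
        also have "\<dots> \<le> e\<^sup>2"
          using N[OF \<open>n \<ge> N\<close> \<open>m \<ge> N\<close>] by (intro power_mono) auto
        finally show ?thesis .
      qed
      then show "\<exists>N. \<forall>m\<ge>N. (\<Sum>x\<in>A. (coord (X n) x - coord (X m) x)\<^sup>2) \<le> e\<^sup>2" by blast
    qed
    then show ?thesis by blast
  qed
  define d where "d n = Abs_ell2 (\<lambda>x. coord (X n) x - f x)" for n
  have d: "\<exists>N. \<forall>n\<ge>N. coord (d n) = (\<lambda>x. coord (X n) x - f x) \<and> norm (d n) \<le> e" if "0 < e" for e
  proof -
    obtain N where "\<And>n A. n \<ge> N \<Longrightarrow> finite A \<Longrightarrow> (\<Sum>x\<in>A. (coord (X n) x - f x)\<^sup>2) \<le> e\<^sup>2"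
      using tail[OF \<open>0 < e\<close>] by blast
    then have "coord (d n) = (\<lambda>x. coord (X n) x - f x) \<and> norm (d n) \<le> e" if "n \<ge> N" for n
      unfolding d_def
      using ell2_of_bounded_partial_sums[of "\<lambda>x. coord (X n) x - f x" e] \<open>0 < e\<close> that by simp
    then show ?thesis by blast
  qed
  from d[of 1] obtain N where N: "\<And>n. n \<ge> N \<Longrightarrow> coord (d n) = (\<lambda>x. coord (X n) x - f x)"
    by (metis zero_less_one)
  \<comment> \<open>The pointwise limit \<open>f\<close> is not yet known to be square summable;
    only its difference from a late term is. Subtracting that difference from the term produces a
    vector with coordinates \<open>f\<close>.\<close>
  define g where "g = X N - d N"
  have g: "coord g = f" unfolding g_def using N[of N] by (auto simp: fun_eq_iff)
  have "X \<longlonglongrightarrow> g"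
  proof (rule LIMSEQ_I)
    fix r :: real assume "0 < r"
    then obtain M where M: "\<And>n. n \<ge> M \<Longrightarrow> coord (d n) = (\<lambda>x. coord (X n) x - f x) \<and> norm (d n) \<le> r / 2"
      using d[of "r / 2"] by auto
    have "norm (X n - g) < r" if "n \<ge> M" for n
    proof -
      have "X n - g = d n" using M[OF that] g by (intro ell2_eqI) auto
      then show ?thesis using M[OF that] \<open>0 < r\<close> by auto
    qed
    then show "\<exists>no. \<forall>n\<ge>no. norm (X n - g) < r" by blast
  qed
  then show "convergent X" by (auto simp: convergent_def)
qed

lift_definition unit :: "'b \<Rightarrow> 'b ell2" is "\<lambda>x y. if y = x then 1 else 0"
proof -
  fix x :: 'b
  have "(\<lambda>y. (if y = x then 1 else 0 :: real)\<^sup>2) summable_on UNIV \<longleftrightarrow> (\<lambda>y. 1::real) summable_on {x}"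
    by (rule summable_on_cong_neutral) auto
  then show "(\<lambda>y. (if y = x then 1 else 0 :: real)\<^sup>2) summable_on UNIV" by simp
qed

lemma coord_unit: "coord (unit x) y = (if y = x then 1 else 0)"
  by transfer simp

lemma inner_unit [simp]: "unit x \<bullet> f = coord f x" "f \<bullet> unit x = coord f x"
proof -
  show *: "unit x \<bullet> f = coord f x"
  proof transfer
    fix x :: 'a and f :: "'a \<Rightarrow> real"
    have "(\<Sum>\<^sub>\<infinity>y. (if y = x then 1 else 0) * f y) = (\<Sum>\<^sub>\<infinity>y\<in>{x}. f y)"
      by (rule infsum_cong_neutral) auto
    then show "(\<Sum>\<^sub>\<infinity>y. (if y = x then 1 else 0) * f y) = f x" by simp
  qed
  show "f \<bullet> unit x = coord f x" using * by (simp add: inner_commute)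
qed

lemma norm_unit [simp]: "norm (unit x) = 1"
  by (simp add: norm_eq_sqrt_inner coord_unit)

text \<open>The absence of isolated points is the type-class form of being a nonzero space. It makes
  the identity operator have norm 1, as a unital normed algebra requires.\<close>

instance ell2 :: (type) perfect_space
proof
  fix x :: "'a ell2"
  show "\<not> open {x}"
  proof
    assume "open {x}"
    then obtain e where e: "e > 0" "\<And>y. dist y x < e \<Longrightarrow> y \<in> {x}" by (metis open_dist singletonI)
    define y where "y = x + (e / 2) *\<^sub>R unit (undefined :: 'a)"
    have "dist y x < e" using e(1) by (simp add: y_def dist_norm)
    then have "(e / 2) *\<^sub>R unit (undefined :: 'a) = 0" using e(2)[of y] by (simp add: y_def)
    then have "norm ((e / 2) *\<^sub>R unit (undefined :: 'a)) = 0" by (simp only: norm_zero)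
    then show False using e(1) by simp
  qed
qed

section \<open>Approximation by finitely supported vectors\<close>

definition truncate :: "'b set \<Rightarrow> 'b ell2 \<Rightarrow> 'b ell2" where
  "truncate A f = (\<Sum>x\<in>A. coord f x *\<^sub>R unit x)"

lemma coord_sum: "coord (sum f A) x = (\<Sum>a\<in>A. coord (f a) x)"
  by (induction A rule: infinite_finite_induct) simp_all

lemma coord_truncate: "finite A \<Longrightarrow> coord (truncate A f) x = (if x \<in> A then coord f x else 0)"
  unfolding truncate_def coord_sum by (simp add: coord_unit if_distrib sum.delta cong: if_cong)

lemma inner_truncate_self: "truncate A f \<bullet> f = (\<Sum>x\<in>A. (coord f x)\<^sup>2)"
  unfolding truncate_def by (simp add: inner_sum_left power2_eq_square)

lemma norm_truncate: "finite A \<Longrightarrow> (norm (truncate A f))\<^sup>2 = (\<Sum>x\<in>A. (coord f x)\<^sup>2)"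
  unfolding power2_norm_eq_inner
  by (subst (2) truncate_def) (simp add: inner_sum_right coord_truncate power2_eq_square)

text \<open>By Pythagoras the squared error is the missing part of the sum of squares. Inequalities
  between continuous forms can therefore be checked on finite sums and passed to the limit.\<close>

lemma tendsto_truncate: "((\<lambda>A. truncate A f) \<longlongrightarrow> f) (finite_subsets_at_top UNIV)"
proof -
  have "((\<lambda>x. (coord f x)\<^sup>2) has_sum (norm f)\<^sup>2) UNIV"
    unfolding norm_ell2_square by (intro has_sum_infsum square_summable_coord)
  then have "((\<lambda>A. \<Sum>x\<in>A. (coord f x)\<^sup>2) \<longlongrightarrow> (norm f)\<^sup>2) (finite_subsets_at_top UNIV)"
    by (simp add: has_sum_def)
  then have "((\<lambda>A. (norm f)\<^sup>2 - (\<Sum>x\<in>A. (coord f x)\<^sup>2)) \<longlongrightarrow> (norm f)\<^sup>2 - (norm f)\<^sup>2) (finite_subsets_at_top UNIV)"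
    by (intro tendsto_intros)
  moreover have "(norm f)\<^sup>2 - (\<Sum>x\<in>A. (coord f x)\<^sup>2) = (norm (truncate A f - f))\<^sup>2" if "finite A" for A
    using inner_truncate_self[of A f] norm_truncate[OF that, of f]
    by (simp add: power2_norm_eq_inner inner_diff_left inner_diff_right inner_commute)
  then have "\<forall>\<^sub>F A in finite_subsets_at_top UNIV.
      (norm f)\<^sup>2 - (\<Sum>x\<in>A. (coord f x)\<^sup>2) = (norm (truncate A f - f))\<^sup>2"
    by (auto intro!: eventually_finite_subsets_at_top_weakI)
  ultimately have "((\<lambda>A. (norm (truncate A f - f))\<^sup>2) \<longlongrightarrow> (norm f)\<^sup>2 - (norm f)\<^sup>2) (finite_subsets_at_top UNIV)"
    by (rule Lim_transform_eventually)
  then have "((\<lambda>A. sqrt ((norm (truncate A f - f))\<^sup>2)) \<longlongrightarrow> sqrt ((norm f)\<^sup>2 - (norm f)\<^sup>2)) (finite_subsets_at_top UNIV)"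
    by (rule tendsto_real_sqrt)
  then have "((\<lambda>A. norm (truncate A f - f)) \<longlongrightarrow> 0) (finite_subsets_at_top UNIV)" by simp
  then show ?thesis by (simp add: LIM_zero_iff tendsto_norm_zero_iff)
qed

section \<open>The Banach algebra of bounded operators\<close>

text \<open>A copy of the type of bounded endomorphisms in which composition is the multiplication,
  so that the theory of \<open>exp\<close> and of geometric series in Banach algebras applies to
  operators.\<close>

typedef (overloaded) 'v blop = "UNIV :: ('v::real_normed_vector \<Rightarrow>\<^sub>L 'v) set"
  morphisms blinfun_of Abs_blop
  by simp

setup_lifting type_definition_blop

instantiation blop :: ("{real_normed_vector, perfect_space}") real_normed_algebra_1
begin

lift_definition zero_blop :: "'a blop" is 0 .
lift_definition one_blop :: "'a blop" is id_blinfun .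
lift_definition plus_blop :: "'a blop \<Rightarrow> 'a blop \<Rightarrow> 'a blop" is "(+)" .
lift_definition minus_blop :: "'a blop \<Rightarrow> 'a blop \<Rightarrow> 'a blop" is "(-)" .
lift_definition uminus_blop :: "'a blop \<Rightarrow> 'a blop" is uminus .
lift_definition times_blop :: "'a blop \<Rightarrow> 'a blop \<Rightarrow> 'a blop" is "(o\<^sub>L)" .
lift_definition scaleR_blop :: "real \<Rightarrow> 'a blop \<Rightarrow> 'a blop" is scaleR .
lift_definition norm_blop :: "'a blop \<Rightarrow> real" is norm .

definition dist_blop :: "'a blop \<Rightarrow> 'a blop \<Rightarrow> real" where "dist_blop A B = norm (A - B)"

definition sgn_blop :: "'a blop \<Rightarrow> 'a blop" where "sgn_blop A = inverse (norm A) *\<^sub>R A"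

definition uniformity_blop :: "('a blop \<times> 'a blop) filter" where
  "uniformity_blop = (INF e\<in>{0 <..}. principal {(x, y). dist x y < e})"

definition open_blop :: "'a blop set \<Rightarrow> bool" where
  "open_blop S = (\<forall>x\<in>S. \<forall>\<^sub>F (x', y) in uniformity. x' = x \<longrightarrow> y \<in> S)"

instance
proof
  fix x y z :: "'a blop" and a b :: real
  show "x + y + z = x + (y + z)" "x + y = y + x" "0 + x = x" "- x + x = 0" "x - y = x + - y"
    "a *\<^sub>R (x + y) = a *\<^sub>R x + a *\<^sub>R y" "(a + b) *\<^sub>R x = a *\<^sub>R x + b *\<^sub>R x"
    "a *\<^sub>R b *\<^sub>R x = (a * b) *\<^sub>R x" "1 *\<^sub>R x = x"
    by (transfer; simp add: algebra_simps)+
  show "x * y * z = x * (y * z)" "1 * x = x" "x * 1 = x" "(x + y) * z = x * z + y * z"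
    "x * (y + z) = x * y + x * z" "a *\<^sub>R x * y = a *\<^sub>R (x * y)" "x * a *\<^sub>R y = a *\<^sub>R (x * y)"
    by (transfer; rule blinfun_eqI; simp add: blinfun.bilinear_simps)+
  have "norm (0 :: 'a blop) = 0" "norm (1 :: 'a blop) = 1" by (transfer; simp)+
  then show "(0 :: 'a blop) \<noteq> 1" by auto
  show "norm (1 :: 'a blop) = 1" by fact
  show "norm x = 0 \<longleftrightarrow> x = 0" "norm (x + y) \<le> norm x + norm y" "norm (a *\<^sub>R x) = \<bar>a\<bar> * norm x"
    "norm (x * y) \<le> norm x * norm y"
    by (transfer; simp add: norm_triangle_ineq norm_blinfun_compose)+
qed (simp_all add: dist_blop_def sgn_blop_def uniformity_blop_def open_blop_def)

end

instance blop :: ("{banach, perfect_space}") banach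
proof
  fix X :: "nat \<Rightarrow> 'a blop"
  assume "Cauchy X"
  have d: "dist (blinfun_of A) (blinfun_of B) = dist A B" for A B :: "'a blop"
    unfolding dist_norm by transfer simp
  have "Cauchy (\<lambda>n. blinfun_of (X n))"
    using \<open>Cauchy X\<close> unfolding Cauchy_def d .
  then obtain L where L: "(\<lambda>n. blinfun_of (X n)) \<longlonglongrightarrow> L"
    using Cauchy_convergent convergent_def by blast
  have "X \<longlonglongrightarrow> Abs_blop L"
    using L d[of _ "Abs_blop L"] unfolding lim_sequentially by (simp add: Abs_blop_inverse)
  then show "convergent X" by (auto simp: convergent_def)
qed

lift_definition app :: "'v::{real_normed_vector, perfect_space} blop \<Rightarrow> 'v \<Rightarrow> 'v" is blinfun_apply .

definition blop_of :: "('v \<Rightarrow> 'v) \<Rightarrow> 'v::{real_normed_vector, perfect_space} blop" where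
  "blop_of f = Abs_blop (Blinfun f)"

lemma app_blop_of: "bounded_linear f \<Longrightarrow> app (blop_of f) x = f x"
  by (simp add: blop_of_def app.rep_eq Abs_blop_inverse bounded_linear_Blinfun_apply)

lemma bounded_bilinear_app: "bounded_bilinear app"
proof
  fix A B :: "'a blop" and x y :: 'a and r :: real
  show "app (A + B) x = app A x + app B x" "app A (x + y) = app A x + app A y"
    "app (r *\<^sub>R A) x = r *\<^sub>R app A x" "app A (r *\<^sub>R x) = r *\<^sub>R app A x"
    by (transfer; simp add: blinfun.bilinear_simps)+
  have "norm (app A x) \<le> norm A * norm x" for A :: "'a blop" and x
    by transfer (rule norm_blinfun)
  then show "\<exists>K. \<forall>A x. norm (app (A :: 'a blop) x) \<le> norm A * norm x * K"
    by (metis mult.right_neutral)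
qed

interpretation app: bounded_bilinear app by (rule bounded_bilinear_app)

lemma app_times [simp]: "app (A * B) x = app A (app B x)"
  by transfer simp

lemma app_one [simp]: "app 1 x = x"
  by transfer simp

lemma norm_app_le: "norm (app A x) \<le> norm A * norm x"
  by transfer (rule norm_blinfun)

lemma sums_app_exp:
  fixes A :: "'v::{banach, perfect_space} blop"
  shows "(\<lambda>n. app (A ^ n) x /\<^sub>R fact n) sums app (exp A) x"
proof -
  have "(\<lambda>n. app (A ^ n /\<^sub>R fact n) x) sums app (exp A) x"
    by (rule bounded_linear.sums[OF app.bounded_linear_left exp_converges])
  then show ?thesis by (simp add: app.scaleR_left)
qed

text \<open>Neumann series: the two-sided inverse is the sum of the powers of
  \<open>A\<close>.\<close>

lemma one_minus_invertible:
  fixes A :: "'v::{real_normed_algebra_1, banach}"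
  assumes "norm A < 1"
  obtains S where "S * (1 - A) = 1" and "(1 - A) * S = 1"
proof
  have "summable (\<lambda>n. norm A ^ n)" using assms by (intro summable_geometric) simp
  then have s: "summable (\<lambda>n. A ^ n)"
    by (rule summable_comparison_test'[where N = 0]) (simp add: norm_power_ineq)
  have e: "(\<Sum>n. A ^ Suc n) = (\<Sum>n. A ^ n) - 1"
    using suminf_split_head[OF s] by simp
  show "(\<Sum>n. A ^ n) * (1 - A) = 1"
    using suminf_mult2[OF s, of A] e by (simp add: right_diff_distrib power_commutes)
  show "(1 - A) * (\<Sum>n. A ^ n) = 1"
    using suminf_mult[OF s, of A] e by (simp add: left_diff_distrib)
qed

section \<open>Adjoints and multiplication operators\<close>

lemma tendsto_app_truncate:
  "((\<lambda>S. app A (truncate S f)) \<longlongrightarrow> app A f) (finite_subsets_at_top UNIV)"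
  by (rule app.tendsto[OF tendsto_const tendsto_truncate])

lemma ell2_bounded_linear_eqI:
  fixes \<phi> \<psi> :: "'b ell2 \<Rightarrow> 'v::real_normed_vector"
  assumes "bounded_linear \<phi>" and "bounded_linear \<psi>" and "\<And>x. \<phi> (unit x) = \<psi> (unit x)"
  shows "\<phi> f = \<psi> f"
proof -
  interpret \<phi>: bounded_linear \<phi> by fact
  interpret \<psi>: bounded_linear \<psi> by fact
  have "\<phi> (truncate S f) = \<psi> (truncate S f)" for S
    unfolding truncate_def by (simp add: \<phi>.sum \<psi>.sum \<phi>.scaleR \<psi>.scaleR assms(3))
  then have "((\<lambda>S. \<phi> (truncate S f)) \<longlongrightarrow> \<psi> f) (finite_subsets_at_top UNIV)"
    using \<psi>.tendsto[OF tendsto_truncate] by simp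
  with \<phi>.tendsto[OF tendsto_truncate] show ?thesis
    by (rule tendsto_unique[rotated]) simp
qed

text \<open>The representing vector can only have the coordinates \<open>\<phi> (unit x)\<close>.
  The point is that they are square summable; equality then follows from the density of finite
  combinations of the vectors \<open>unit x\<close>.\<close>

lemma ell2_riesz:
  fixes \<phi> :: "'b ell2 \<Rightarrow> real"
  assumes "bounded_linear \<phi>"
  obtains h where "\<And>f. \<phi> f = f \<bullet> h"
proof -
  interpret bounded_linear \<phi> by fact
  obtain K where K: "K \<ge> 0" "\<And>f. norm (\<phi> f) \<le> norm f * K" using nonneg_bounded by blast
  have "(\<Sum>x\<in>S. (\<phi> (unit x))\<^sup>2) \<le> K\<^sup>2" if S: "finite S" for S
  proof -
    \<comment> \<open>Testing the functional on its own candidate vector gives norm v ^ 2 = \<phi>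
      v, which is at most K * norm v, so every partial sum is bounded by K ^ 2.\<close>
    define v where "v = (\<Sum>x\<in>S. \<phi> (unit x) *\<^sub>R unit x)"
    have "coord v x = \<phi> (unit x)" if "x \<in> S" for x
      unfolding v_def coord_sum using that S by (simp add: coord_unit if_distrib sum.delta cong: if_cong)
    then have "v \<bullet> v = (\<Sum>x\<in>S. (\<phi> (unit x))\<^sup>2)"
      by (subst v_def) (simp add: inner_sum_left power2_eq_square)
    moreover have "\<phi> v = (\<Sum>x\<in>S. (\<phi> (unit x))\<^sup>2)"
      unfolding v_def by (simp add: sum scaleR power2_eq_square)
    ultimately have *: "(norm v)\<^sup>2 = (\<Sum>x\<in>S. (\<phi> (unit x))\<^sup>2)" "(norm v)\<^sup>2 \<le> norm v * K"
      using K(2)[of v] by (auto simp: power2_norm_eq_inner)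
    have "norm v * norm v \<le> norm v * K" using *(2) by (simp add: power2_eq_square)
    then have "norm v \<le> K" using K(1) by (cases "v = 0") (simp_all add: mult_le_cancel_left)
    then show ?thesis unfolding *(1)[symmetric] by (intro power_mono) auto
  qed
  then have h: "coord (Abs_ell2 (\<lambda>x. \<phi> (unit x))) = (\<lambda>x. \<phi> (unit x))"
    using K(1) by (rule ell2_of_bounded_partial_sums)
  have "\<phi> f = f \<bullet> Abs_ell2 (\<lambda>x. \<phi> (unit x))" for f
    by (rule ell2_bounded_linear_eqI) (simp_all add: assms bounded_linear_inner_left h)
  then show thesis by (rule that)
qed

lemma adjoint_exists:
  fixes A :: "'b ell2 blop"
  shows "\<exists>B. \<forall>f g. app A f \<bullet> g = f \<bullet> app B g"
proof -
  have "bounded_linear (\<lambda>f. app A f \<bullet> g)" for g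
    by (rule bounded_linear_compose[OF bounded_linear_inner_left app.bounded_linear_right])
  then have "\<exists>h. \<forall>f. app A f \<bullet> g = f \<bullet> h" for g
    by (metis ell2_riesz)
  then obtain B where B: "\<And>f g. app A f \<bullet> g = f \<bullet> B g" by metis
  have "bounded_linear B"
  proof
    show "B (g + h) = B g + B h" for g h
      by (rule vector_eq_ldot[THEN iffD1]) (simp add: B[symmetric] inner_add_right)
    show "B (r *\<^sub>R g) = r *\<^sub>R B g" for r g
      by (rule vector_eq_ldot[THEN iffD1]) (simp add: B[symmetric])
    have "norm (B g) \<le> norm g * norm A" for g
    proof -
      have "(norm (B g))\<^sup>2 = app A (B g) \<bullet> g" by (simp add: B power2_norm_eq_inner)
      also have "\<dots> \<le> norm (app A (B g)) * norm g" by (rule norm_cauchy_schwarz)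
      also have "\<dots> \<le> norm A * norm (B g) * norm g" by (intro mult_right_mono norm_app_le) simp
      finally have "norm (B g) * norm (B g) \<le> norm (B g) * (norm g * norm A)"
        by (simp only: power2_eq_square ac_simps)
      then show ?thesis
        by (cases "B g = 0") (simp_all add: mult_le_cancel_left)
    qed
    then show "\<exists>K. \<forall>g. norm (B g) \<le> norm g * K" by blast
  qed
  then show ?thesis by (metis B app_blop_of)
qed

definition adj :: "'b ell2 blop \<Rightarrow> 'b ell2 blop" where
  "adj A = (SOME B. \<forall>f g. app A f \<bullet> g = f \<bullet> app B g)"

lemma inner_app_left: "app A f \<bullet> g = f \<bullet> app (adj A) g"
  unfolding adj_def using someI_ex[OF adjoint_exists[of A]] by blast

definition multiplier :: "('b \<Rightarrow> real) \<Rightarrow> 'b ell2 blop" where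
  "multiplier m = blop_of (\<lambda>f. Abs_ell2 (\<lambda>x. m x * coord f x))"

lemma coord_multiplier:
  assumes "\<And>x. \<bar>m x\<bar> \<le> C"
  shows "coord (app (multiplier m) f) x = m x * coord f x"
proof -
  have C: "0 \<le> C" using assms[of undefined] by linarith
  have le: "(\<Sum>x\<in>S. (m x * coord f x)\<^sup>2) \<le> (C * norm f)\<^sup>2" if "finite S" for S f
  proof -
    have "(m x * coord f x)\<^sup>2 \<le> C\<^sup>2 * (coord f x)\<^sup>2" for x
      using assms[of x] C unfolding power_mult_distrib
      by (intro mult_right_mono) (simp_all add: abs_le_square_iff[symmetric])
    then have "(\<Sum>x\<in>S. (m x * coord f x)\<^sup>2) \<le> C\<^sup>2 * (\<Sum>x\<in>S. (coord f x)\<^sup>2)"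
      unfolding sum_distrib_left by (rule sum_mono)
    also have "\<dots> \<le> C\<^sup>2 * (norm f)\<^sup>2"
      by (intro mult_left_mono sum_coord_square_le that) simp
    finally show ?thesis by (simp add: power_mult_distrib)
  qed
  have c: "coord (Abs_ell2 (\<lambda>x. m x * coord f x)) = (\<lambda>x. m x * coord f x)"
    and n: "norm (Abs_ell2 (\<lambda>x. m x * coord f x)) \<le> C * norm f" for f
    using ell2_of_bounded_partial_sums[of "\<lambda>x. m x * coord f x" "C * norm f"] le C by simp_all
  have "bounded_linear (\<lambda>f. Abs_ell2 (\<lambda>x. m x * coord f x))"
  proof
    show "\<exists>K. \<forall>f. norm (Abs_ell2 (\<lambda>x. m x * coord f x)) \<le> norm f * K"
      using n by (metis mult.commute)
    show "Abs_ell2 (\<lambda>x. m x * coord (f + g) x) =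
        Abs_ell2 (\<lambda>x. m x * coord f x) + Abs_ell2 (\<lambda>x. m x * coord g x)" for f g
      by (rule ell2_eqI) (simp only: c, simp only: coord_simps(2) c distrib_left)
    show "Abs_ell2 (\<lambda>x. m x * coord (r *\<^sub>R f) x) = r *\<^sub>R Abs_ell2 (\<lambda>x. m x * coord f x)" for r f
      by (rule ell2_eqI) (simp only: c, simp only: coord_simps(5) c mult.left_commute)
  qed
  then show ?thesis unfolding multiplier_def by (simp add: app_blop_of c)
qed

section \<open>Davies' method\<close>

text \<open>Only the even part \<open>cosh\<close> of the twist survives symmetrisation, and a weighted Schur test
  with weights \<open>r\<close> controls its deviation from \<open>1\<close>.\<close>

lemma twisted_sum_ge:
  fixes a :: "'b \<Rightarrow> 'b \<Rightarrow> real" and \<psi> r g :: "'b \<Rightarrow> real"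
  assumes sym: "\<And>x y. a x y = a y x" and r: "\<And>x. 0 < r x"
    and schur: "\<And>x. (\<Sum>y\<in>S. \<bar>a x y\<bar> * (r y / r x) * (cosh (\<psi> x - \<psi> y) - 1)) \<le> c"
  shows "(\<Sum>x\<in>S. \<Sum>y\<in>S. a x y * (g x * g y)) - c * (\<Sum>x\<in>S. (g x)\<^sup>2)
      \<le> (\<Sum>x\<in>S. \<Sum>y\<in>S. a x y * (g x * g y) * exp (\<psi> y - \<psi> x))" (is "?L \<le> ?T")
proof -
  define k where "k x y = cosh (\<psi> x - \<psi> y) - 1" for x y
  have k: "k x y \<ge> 0" "k x y = k y x" for x y
    unfolding k_def using cosh_real_ge_1[of "\<psi> x - \<psi> y"] cosh_minus[of "\<psi> x - \<psi> y"] by auto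
  define b where "b x y = \<bar>a x y\<bar> * (r y / r x) * k x y" for x y
  \<comment> \<open>Exchanging the two indices reverses the sign of the exponent, because the other
    factors are symmetric. Averaging both versions replaces \<open>exp\<close> by
    \<open>cosh\<close>.\<close>
  have T': "?T = (\<Sum>x\<in>S. \<Sum>y\<in>S. a x y * (g x * g y) * exp (\<psi> x - \<psi> y))"
    by (subst sum.swap) (simp add: sym mult.commute[of "g _" "g _"])
  have "2 * ?T = ?T + (\<Sum>x\<in>S. \<Sum>y\<in>S. a x y * (g x * g y) * exp (\<psi> x - \<psi> y))"
    using T' by simp
  also have "\<dots> = (\<Sum>x\<in>S. \<Sum>y\<in>S. a x y * (g x * g y) * (2 * cosh (\<psi> x - \<psi> y)))"
    unfolding sum.distrib[symmetric] by (intro sum.cong refl) (simp add: cosh_field_def field_simps)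
  also have "\<dots> = 2 * (\<Sum>x\<in>S. \<Sum>y\<in>S. a x y * (g x * g y) * cosh (\<psi> x - \<psi> y))"
    by (simp add: sum_distrib_left mult.left_commute mult.assoc)
  finally have T: "?T = (\<Sum>x\<in>S. \<Sum>y\<in>S. a x y * (g x * g y) * cosh (\<psi> x - \<psi> y))"
    by simp
  have termwise: "a x y * (g x * g y) - ((g x)\<^sup>2 * b x y + (g y)\<^sup>2 * b y x) / 2
      \<le> a x y * (g x * g y) * cosh (\<psi> x - \<psi> y)" for x y
  proof -
    \<comment> \<open>The two square roots multiply to 1, so this splits |g x| |g y| by the
      arithmetic-geometric mean in exactly the proportion that produces the weighted row sums of the
      Schur hypothesis.\<close>
    have "2 * (\<bar>g x\<bar> * sqrt (r y / r x)) * (\<bar>g y\<bar> * sqrt (r x / r y))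
        \<le> (\<bar>g x\<bar> * sqrt (r y / r x))\<^sup>2 + (\<bar>g y\<bar> * sqrt (r x / r y))\<^sup>2"
      by (rule sum_squares_bound)
    moreover have "2 * (\<bar>g x\<bar> * sqrt (r y / r x)) * (\<bar>g y\<bar> * sqrt (r x / r y))
        = 2 * (\<bar>g x\<bar> * \<bar>g y\<bar>) * (sqrt (r y / r x) * sqrt (r x / r y))"
      by (simp only: mult_ac)
    moreover have "sqrt (r y / r x) * sqrt (r x / r y) = 1"
      using r[of x] r[of y] by (simp add: real_sqrt_mult[symmetric])
    ultimately have "2 * (\<bar>g x\<bar> * \<bar>g y\<bar>) \<le> (g x)\<^sup>2 * (r y / r x) + (g y)\<^sup>2 * (r x / r y)"
      using r[of x] r[of y] by (simp add: power_mult_distrib)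
    then have "\<bar>a x y\<bar> * k x y * (2 * (\<bar>g x\<bar> * \<bar>g y\<bar>))
        \<le> \<bar>a x y\<bar> * k x y * ((g x)\<^sup>2 * (r y / r x) + (g y)\<^sup>2 * (r x / r y))"
      by (intro mult_left_mono mult_nonneg_nonneg k) auto
    also have "\<dots> = (g x)\<^sup>2 * b x y + (g y)\<^sup>2 * b y x"
      unfolding b_def sym[of y x] k(2)[of y x] by (simp add: algebra_simps)
    finally have "\<bar>a x y\<bar> * k x y * (\<bar>g x\<bar> * \<bar>g y\<bar>) \<le> ((g x)\<^sup>2 * b x y + (g y)\<^sup>2 * b y x) / 2"
      by simp
    moreover have "- (\<bar>a x y\<bar> * k x y * (\<bar>g x\<bar> * \<bar>g y\<bar>)) \<le> a x y * k x y * (g x * g y)"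
      using abs_ge_minus_self[of "a x y * k x y * (g x * g y)"] k(1)[of x y] by (simp add: abs_mult)
    ultimately have "- (((g x)\<^sup>2 * b x y + (g y)\<^sup>2 * b y x) / 2) \<le> a x y * k x y * (g x * g y)"
      by linarith
    moreover have "a x y * (g x * g y) * cosh (\<psi> x - \<psi> y) = a x y * (g x * g y) + a x y * k x y * (g x * g y)"
      unfolding k_def by (simp add: algebra_simps)
    ultimately show ?thesis by linarith
  qed
  have "(\<Sum>x\<in>S. \<Sum>y\<in>S. (g y)\<^sup>2 * b y x) = (\<Sum>x\<in>S. \<Sum>y\<in>S. (g x)\<^sup>2 * b x y)"
    by (rule sum.swap)
  then have "(\<Sum>x\<in>S. \<Sum>y\<in>S. (g x)\<^sup>2 * b x y + (g y)\<^sup>2 * b y x) / 2 = (\<Sum>x\<in>S. (g x)\<^sup>2 * (\<Sum>y\<in>S. b x y))"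
    unfolding sum.distrib sum_distrib_left by simp
  then have "(\<Sum>x\<in>S. \<Sum>y\<in>S. ((g x)\<^sup>2 * b x y + (g y)\<^sup>2 * b y x) / 2) = (\<Sum>x\<in>S. (g x)\<^sup>2 * (\<Sum>y\<in>S. b x y))"
    by (simp only: sum_divide_distrib)
  also have "\<dots> \<le> (\<Sum>x\<in>S. (g x)\<^sup>2 * c)"
    using schur unfolding b_def k_def by (intro sum_mono mult_left_mono) auto
  finally have "?L \<le> (\<Sum>x\<in>S. \<Sum>y\<in>S. a x y * (g x * g y) - ((g x)\<^sup>2 * b x y + (g y)\<^sup>2 * b y x) / 2)"
    by (simp add: sum_subtractf sum_distrib_left mult.commute)
  also have "\<dots> \<le> ?T"
    unfolding T by (intro sum_mono termwise)
  finally show ?thesis .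
qed

lemma inner_truncate: "app A (truncate S f) \<bullet> truncate S g
    = (\<Sum>x\<in>S. \<Sum>y\<in>S. coord (app A (unit x)) y * (coord f x * coord g y))"
proof -
  have "app A (truncate S f) \<bullet> truncate S g = (\<Sum>x\<in>S. coord f x * (app A (unit x) \<bullet> truncate S g))"
    unfolding truncate_def[of S f] app.sum_right app.scaleR_right inner_sum_left inner_scaleR_left ..
  then show ?thesis
    unfolding truncate_def by (simp add: inner_sum_right sum_distrib_left mult_ac)
qed

text \<open>With g = M f the right-hand side is the twisted form of g, with A applied to M^-1 g and
  tested against M g; writing it in terms of f avoids the inverse. Truncation commutes with
  \<open>M\<close>, so the finite inequality applies to truncations of g and both sides
  converge.\<close>

lemma twisted_form_ge:
  fixes A :: "'b ell2 blop" and \<psi> r :: "'b \<Rightarrow> real"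
  assumes sym: "\<And>x y. coord (app A (unit x)) y = coord (app A (unit y)) x"
    and lower: "\<And>f. lam * (norm f)\<^sup>2 \<le> app A f \<bullet> f"
    and bounded: "\<And>x. \<bar>\<psi> x\<bar> \<le> C" and r: "\<And>x. 0 < r x"
    and schur: "\<And>S x. finite S \<Longrightarrow>
      (\<Sum>y\<in>S. \<bar>coord (app A (unit x)) y\<bar> * (r y / r x) * (cosh (\<psi> x - \<psi> y) - 1)) \<le> c"
  defines "M \<equiv> multiplier (\<lambda>x. exp (\<psi> x))"
  shows "(lam - c) * (norm (app M f))\<^sup>2 \<le> app A f \<bullet> app M (app M f)"
proof -
  have cM: "coord (app M f) x = exp (\<psi> x) * coord f x" for f x
    unfolding M_def using bounded by (intro coord_multiplier[where C = "exp C"]) (simp add: abs_le_iff)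
  have "(lam - c) * (norm (app M (truncate S f)))\<^sup>2
      \<le> app A (truncate S f) \<bullet> app M (app M (truncate S f))" if S: "finite S" for S
  proof -
    define g where "g = app M f"
    define a where "a x y = coord (app A (unit x)) y" for x y
    have g1: "app M (truncate S f) = truncate S g"
      unfolding g_def by (rule ell2_eqI) (simp add: cM coord_truncate S)
    have g2: "app M (truncate S g) = truncate S (app M g)"
      by (rule ell2_eqI) (simp add: cM coord_truncate S)
    have "lam * (\<Sum>x\<in>S. (coord g x)\<^sup>2) \<le> (\<Sum>x\<in>S. \<Sum>y\<in>S. a x y * (coord g x * coord g y))"
      using lower[of "truncate S g"] by (simp add: norm_truncate S inner_truncate a_def)
    moreover have "(\<Sum>x\<in>S. \<Sum>y\<in>S. a x y * (coord g x * coord g y)) - c * (\<Sum>x\<in>S. (coord g x)\<^sup>2)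
        \<le> (\<Sum>x\<in>S. \<Sum>y\<in>S. a x y * (coord g x * coord g y) * exp (\<psi> y - \<psi> x))"
    proof (rule twisted_sum_ge[where r = r])
      show "a x y = a y x" for x y unfolding a_def by (rule sym)
      show "(\<Sum>y\<in>S. \<bar>a x y\<bar> * (r y / r x) * (cosh (\<psi> x - \<psi> y) - 1)) \<le> c" for x
        unfolding a_def by (rule schur[OF S])
    qed (rule r)
    moreover have "\<dots> = (\<Sum>x\<in>S. \<Sum>y\<in>S. a x y * (coord f x * coord (app M g) y))"
      by (intro sum.cong refl) (simp add: g_def cM exp_diff)
    ultimately show ?thesis
      unfolding g1 g2 by (simp add: norm_truncate S inner_truncate a_def algebra_simps)
  qed
  moreover have "((\<lambda>S. (lam - c) * (norm (app M (truncate S f)))\<^sup>2) \<longlongrightarrow> (lam - c) * (norm (app M f))\<^sup>2)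
      (finite_subsets_at_top UNIV)"
    by (intro tendsto_intros tendsto_app_truncate)
  moreover have "((\<lambda>S. app A (truncate S f) \<bullet> app M (app M (truncate S f))) \<longlongrightarrow> app A f \<bullet> app M (app M f))
      (finite_subsets_at_top UNIV)"
    by (intro tendsto_inner tendsto_app_truncate app.tendsto[OF tendsto_const])
  ultimately show ?thesis
    by (intro tendsto_le[of "finite_subsets_at_top UNIV"])
       (auto intro!: eventually_finite_subsets_at_top_weakI)
qed

text \<open>Gronwall: for u(s) = M e^(-sA) f the squared norm has derivative -2 <M A e^(-sA) f,
  u(s)>, which is at most -2 \<kappa> norm (u s) ^ 2, so exp (2 \<kappa> s) times the squared norm
  is nonincreasing.\<close>

lemma exp_semigroup_decay:
  fixes A M :: "'v::{real_inner, banach, perfect_space} blop"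
  assumes lower: "\<And>f. \<kappa> * (norm (app M f))\<^sup>2 \<le> app M (app A f) \<bullet> app M f" and "0 \<le> t"
  shows "norm (app M (app (exp (t *\<^sub>R (- A))) f)) \<le> exp (- \<kappa> * t) * norm (app M f)"
proof -
  define v where "v s = app (exp (s *\<^sub>R (- A))) f" for s
  define u where "u s = app M (v s)" for s
  have "(v has_vector_derivative - app A (v s)) (at s)" for s
  proof -
    have "((\<lambda>s. app (exp (s *\<^sub>R (- A))) f) has_vector_derivative app (- A * exp (s *\<^sub>R (- A))) f) (at s)"
      by (rule bounded_linear.has_vector_derivative[OF app.bounded_linear_left
            exp_scaleR_has_vector_derivative_left])
    then show ?thesis unfolding v_def by (simp add: app.minus_left)
  qed
  then have du: "(u has_vector_derivative - app M (app A (v s))) (at s)" for s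
    unfolding u_def using bounded_linear.has_vector_derivative[OF app.bounded_linear_right]
    by (metis app.minus_right)
  have deriv: "((\<lambda>s. (u s \<bullet> u s) * exp (2 * \<kappa> * s)) has_real_derivative
      (2 * \<kappa> * (u s \<bullet> u s) - 2 * (app M (app A (v s)) \<bullet> u s)) * exp (2 * \<kappa> * s)) (at s)" for s
  proof -
    have "((\<lambda>s. u s \<bullet> u s) has_real_derivative - 2 * (app M (app A (v s)) \<bullet> u s)) (at s)"
      using has_derivative_inner[OF du[of s, unfolded has_vector_derivative_def]
          du[of s, unfolded has_vector_derivative_def]]
      unfolding has_field_derivative_def
      by (elim has_derivative_eq_rhs) (simp add: fun_eq_iff inner_commute algebra_simps)
    then show ?thesis
      by (auto intro!: derivative_eq_intros simp: algebra_simps)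
  qed
  have "(u t \<bullet> u t) * exp (2 * \<kappa> * t) \<le> (u 0 \<bullet> u 0) * exp (2 * \<kappa> * 0)"
  proof (rule DERIV_nonpos_imp_nonincreasing[OF \<open>0 \<le> t\<close>])
    fix s
    have "(2 * \<kappa> * (u s \<bullet> u s) - 2 * (app M (app A (v s)) \<bullet> u s)) * exp (2 * \<kappa> * s) \<le> 0"
      using lower[of "v s"] unfolding u_def
      by (intro mult_nonpos_nonneg) (simp_all add: power2_norm_eq_inner)
    with deriv[of s] show "\<exists>y. ((\<lambda>s. (u s \<bullet> u s) * exp (2 * \<kappa> * s)) has_real_derivative y) (at s) \<and> y \<le> 0"
      by blast
  qed
  then have "(norm (u t))\<^sup>2 * (exp (\<kappa> * t))\<^sup>2 \<le> (norm (u 0))\<^sup>2"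
    by (simp add: power2_norm_eq_inner exp_double[symmetric] mult.assoc)
  then have "norm (u t) * exp (\<kappa> * t) \<le> norm (u 0)"
    by (metis norm_ge_zero power2_le_imp_le power_mult_distrib)
  then have "norm (u t) \<le> exp (- \<kappa> * t) * norm (u 0)"
    by (simp add: exp_minus field_simps)
  then show ?thesis by (simp add: u_def v_def)
qed

text \<open>The twist acts on the starting vector \<open>unit p\<close> as the scalar exp (\<psi> p)
  and multiplies the coordinate at \<open>q\<close> by exp (\<psi> q). Decay of the twisted norm
  thus bounds a single entry with the factor exp (\<psi> p - \<psi> q).\<close>

theorem davies_estimate:
  fixes A :: "'b ell2 blop" and \<psi> r :: "'b \<Rightarrow> real"
  assumes sym: "\<And>x y. coord (app A (unit x)) y = coord (app A (unit y)) x"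
    and lower: "\<And>f. lam * (norm f)\<^sup>2 \<le> app A f \<bullet> f"
    and bounded: "\<And>x. \<bar>\<psi> x\<bar> \<le> C" and r: "\<And>x. 0 < r x"
    and schur: "\<And>S x. finite S \<Longrightarrow>
      (\<Sum>y\<in>S. \<bar>coord (app A (unit x)) y\<bar> * (r y / r x) * (cosh (\<psi> x - \<psi> y) - 1)) \<le> c"
    and "0 \<le> t"
  shows "\<bar>coord (app (exp (t *\<^sub>R (- A))) (unit p)) q\<bar> \<le> exp (- lam * t + c * t + \<psi> p - \<psi> q)"
proof -
  define M where "M = multiplier (\<lambda>x. exp (\<psi> x))"
  have cM: "coord (app M f) x = exp (\<psi> x) * coord f x" for f x
    unfolding M_def using bounded by (intro coord_multiplier[where C = "exp C"]) (simp add: abs_le_iff)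
  have "app M (unit p) = exp (\<psi> p) *\<^sub>R unit p"
    by (rule ell2_eqI) (simp add: cM coord_unit)
  then have Mp: "norm (app M (unit p)) = exp (\<psi> p)" by simp
  \<comment> \<open>Moving one copy of \<open>M\<close> across the inner product identifies the
    hypothesis of the decay lemma with the form bounded in \<open>twisted_form_ge\<close>.\<close>
  have M_sym: "app M f \<bullet> g = f \<bullet> app M g" for f g
  proof -
    have "app M f \<bullet> g = (\<Sum>\<^sub>\<infinity>x. coord (app M f) x * coord g x)" by (rule inner_ell2.rep_eq)
    also have "\<dots> = (\<Sum>\<^sub>\<infinity>x. coord f x * coord (app M g) x)" by (simp add: cM mult_ac)
    also have "\<dots> = f \<bullet> app M g" by (rule inner_ell2.rep_eq[symmetric])
    finally show ?thesis .
  qed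
  have "exp (\<psi> q) * \<bar>coord (app (exp (t *\<^sub>R (- A))) (unit p)) q\<bar>
      \<le> norm (app M (app (exp (t *\<^sub>R (- A))) (unit p)))"
    using abs_coord_le_norm[of "app M (app (exp (t *\<^sub>R (- A))) (unit p))" q] by (simp add: cM abs_mult)
  also have "\<dots> \<le> exp (- (lam - c) * t) * norm (app M (unit p))"
  proof (rule exp_semigroup_decay[OF _ \<open>0 \<le> t\<close>])
    show "(lam - c) * (norm (app M f))\<^sup>2 \<le> app M (app A f) \<bullet> app M f" for f
      unfolding M_sym unfolding M_def
      by (rule twisted_form_ge[where r = r, OF sym lower bounded r schur])
  qed
  finally show ?thesis
    by (simp add: Mp exp_add exp_diff exp_minus field_simps left_diff_distrib)
qed

section \<open>Weighted cochains as square-summable families\<close>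

text \<open>The unitary map that turns the weighted inner product into the plain one;
  \<open>cochain_of\<close> inverts it on \<open>supported (faces K i)\<close>.\<close>

definition ell2_of :: "('a set \<Rightarrow> real) \<Rightarrow> ('a set \<Rightarrow> real) \<Rightarrow> 'a set ell2" where
  "ell2_of w f = Abs_ell2 (\<lambda>F. f F * sqrt (w F))"

definition cochain_of :: "'a set set \<Rightarrow> ('a set \<Rightarrow> real) \<Rightarrow> int \<Rightarrow> 'a set ell2 \<Rightarrow> 'a set \<Rightarrow> real" where
  "cochain_of K w i x F = (if F \<in> faces K i then coord x F / sqrt (w F) else 0)"

text \<open>Plays the role of the space of i-cochains: all degrees share one type and are told apart
  by their supports.\<close>

definition supported :: "'b set \<Rightarrow> 'b ell2 set" where
  "supported X = {x. \<forall>y. y \<notin> X \<longrightarrow> coord x y = 0}"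

text \<open>Conjugation by the unitary map. Since \<open>cochain_of\<close> discards coordinates
  outside the i-faces, a linear \<open>T\<close> is extended by 0 to the orthogonal complement. The
  target degree is not recorded, as \<open>ell2_of\<close> depends on the weight only.\<close>

definition transport :: "'a set set \<Rightarrow> ('a set \<Rightarrow> real) \<Rightarrow> int \<Rightarrow>
    (('a set \<Rightarrow> real) \<Rightarrow> 'a set \<Rightarrow> real) \<Rightarrow> 'a set ell2 blop" where
  "transport K w i T = blop_of (\<lambda>x. ell2_of w (T (cochain_of K w i x)))"

text \<open>Leaves \<open>A\<close> free outside the image of the cochains, so that the operator can
  later be altered on the complement and still represent the same \<open>T\<close>.\<close>

definition represents :: "'a set set \<Rightarrow> ('a set \<Rightarrow> real) \<Rightarrow> int \<Rightarrow>
    'a set ell2 blop \<Rightarrow> (('a set \<Rightarrow> real) \<Rightarrow> 'a set \<Rightarrow> real) \<Rightarrow> bool" where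
  "represents K w i A T \<longleftrightarrow> (\<forall>f\<in>l2 K w i. T f \<in> l2 K w i \<and> ell2_of w (T f) = app A (ell2_of w f))"

lemma cochain_of_linear_combination:
  "cochain_of K w i (a *\<^sub>R x + b *\<^sub>R y) = (\<lambda>F. a * cochain_of K w i x F + b * cochain_of K w i y F)"
  by (auto simp: cochain_of_def fun_eq_iff add_divide_distrib)

lemma l2_bounded_op_linear:
  assumes "l2_bounded_op K w i j T" "f \<in> l2 K w i" "g \<in> l2 K w i"
  shows "T (\<lambda>F. a * f F + b * g F) = (\<lambda>F. a * T f F + b * T g F)"
  using assms unfolding l2_bounded_op_def by blast

lemma l2_bounded_op_closed: "l2_bounded_op K w i j T \<Longrightarrow> f \<in> l2 K w i \<Longrightarrow> T f \<in> l2 K w j"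
  unfolding l2_bounded_op_def by blast

lemma representsD:
  assumes "represents K w i A T" "f \<in> l2 K w i"
  shows "T f \<in> l2 K w i" and "ell2_of w (T f) = app A (ell2_of w f)"
  using assms by (auto simp: represents_def)

context
  fixes K :: "'a set set" and w :: "'a set \<Rightarrow> real"
  assumes weighted: "weighted_complex K w"
begin

lemma weight_pos: "F \<in> faces K i \<Longrightarrow> 0 < w F"
  using weighted by (auto simp: weighted_complex_def faces_def)

lemma coord_ell2_of:
  assumes "f \<in> l2 K w i"
  shows "coord (ell2_of w f) F = f F * sqrt (w F)"
proof -
  have "(\<lambda>F. (f F * sqrt (w F))\<^sup>2) summable_on UNIV \<longleftrightarrow> (\<lambda>F. (f F)\<^sup>2 * w F) summable_on faces K i"
    using assms weight_pos
    by (intro summable_on_cong_neutral) (auto simp: l2_def power_mult_distrib less_imp_le)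
  then show ?thesis
    using assms unfolding ell2_of_def by (simp add: l2_def Abs_ell2_inverse)
qed

lemma cochain_of_in_l2: "cochain_of K w i x \<in> l2 K w i"
proof -
  have "(\<lambda>F. (cochain_of K w i x F)\<^sup>2 * w F) summable_on faces K i \<longleftrightarrow>
      (\<lambda>F. (coord x F)\<^sup>2) summable_on faces K i"
  proof (rule summable_on_cong)
    show "(cochain_of K w i x F)\<^sup>2 * w F = (coord x F)\<^sup>2" if "F \<in> faces K i" for F
      using that weight_pos[OF that] by (simp add: cochain_of_def power_divide)
  qed
  then show ?thesis
    by (simp add: l2_def square_summable_coord cochain_of_def)
qed

lemma cochain_of_ell2_of: "f \<in> l2 K w i \<Longrightarrow> cochain_of K w i (ell2_of w f) = f"
  using weight_pos by (fastforce simp: cochain_of_def coord_ell2_of l2_def)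

lemma ell2_of_in_supported: "f \<in> l2 K w i \<Longrightarrow> ell2_of w f \<in> supported (faces K i)"
  by (auto simp: supported_def coord_ell2_of) (auto simp: l2_def)

lemma ell2_of_cochain_of: "x \<in> supported (faces K i) \<Longrightarrow> ell2_of w (cochain_of K w i x) = x"
  using weight_pos
  by (intro ell2_eqI) (fastforce simp: coord_ell2_of[OF cochain_of_in_l2] cochain_of_def supported_def)

lemma ell2_of_inject: "f \<in> l2 K w i \<Longrightarrow> g \<in> l2 K w i \<Longrightarrow> ell2_of w f = ell2_of w g \<Longrightarrow> f = g"
  by (metis cochain_of_ell2_of)

lemma l2_linear_combination:
  assumes "f \<in> l2 K w i" "g \<in> l2 K w i"
  shows "(\<lambda>F. a * f F + b * g F) \<in> l2 K w i"
    and "ell2_of w (\<lambda>F. a * f F + b * g F) = a *\<^sub>R ell2_of w f + b *\<^sub>R ell2_of w g"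
proof -
  have "cochain_of K w i (a *\<^sub>R ell2_of w f + b *\<^sub>R ell2_of w g) = (\<lambda>F. a * f F + b * g F)"
  proof
    fix F
    show "cochain_of K w i (a *\<^sub>R ell2_of w f + b *\<^sub>R ell2_of w g) F = a * f F + b * g F"
    proof (cases "F \<in> faces K i")
      case True
      then show ?thesis
        using weight_pos[OF True]
        by (simp add: cochain_of_def coord_ell2_of[OF assms(1)] coord_ell2_of[OF assms(2)] add_divide_distrib)
    next
      case False
      then show ?thesis using assms by (simp add: cochain_of_def l2_def)
    qed
  qed
  then show *: "(\<lambda>F. a * f F + b * g F) \<in> l2 K w i" by (metis cochain_of_in_l2)
  show "ell2_of w (\<lambda>F. a * f F + b * g F) = a *\<^sub>R ell2_of w f + b *\<^sub>R ell2_of w g"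
    by (rule ell2_eqI) (simp add: coord_ell2_of[OF *] coord_ell2_of[OF assms(1)] coord_ell2_of[OF assms(2)] algebra_simps)
qed

lemma l2_scale:
  assumes "f \<in> l2 K w i"
  shows "(\<lambda>F. a * f F) \<in> l2 K w i" and "ell2_of w (\<lambda>F. a * f F) = a *\<^sub>R ell2_of w f"
  using l2_linear_combination[OF assms assms, of a 0] by simp_all

lemma l2_diff:
  assumes "f \<in> l2 K w i" "g \<in> l2 K w i"
  shows "(\<lambda>F. f F - b * g F) \<in> l2 K w i" and "ell2_of w (\<lambda>F. f F - b * g F) = ell2_of w f - b *\<^sub>R ell2_of w g"
  using l2_linear_combination[OF assms, of 1 "- b"] by simp_all

lemma l2_zero: "(\<lambda>_. 0) \<in> l2 K w i" "ell2_of w (\<lambda>_. 0) = 0"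
  using l2_scale[OF cochain_of_in_l2, of 0] by simp_all

lemma l2_inner_ell2_of:
  assumes "f \<in> l2 K w i" "g \<in> l2 K w i"
  shows "l2_inner K w i f g = ell2_of w f \<bullet> ell2_of w g"
  unfolding l2_inner_def inner_ell2.rep_eq
proof (rule infsum_cong_neutral)
  show "f F * g F * w F = coord (ell2_of w f) F * coord (ell2_of w g) F" if "F \<in> faces K i \<inter> UNIV" for F
    using that weight_pos[of F i] by (simp add: coord_ell2_of[OF assms(1)] coord_ell2_of[OF assms(2)])
  show "coord (ell2_of w f) F * coord (ell2_of w g) F = 0" if "F \<in> UNIV - faces K i" for F
    using that ell2_of_in_supported[OF assms(1)] by (simp add: supported_def)
qed simp

lemma l2_norm_ell2_of: "f \<in> l2 K w i \<Longrightarrow> l2_norm K w i f = norm (ell2_of w f)"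
  by (simp add: l2_norm_def l2_inner_ell2_of norm_eq_sqrt_inner)

lemma norm_ell2_of_cochain_of_le: "norm (ell2_of w (cochain_of K w i x)) \<le> norm x"
proof -
  let ?y = "ell2_of w (cochain_of K w i x)"
  have c: "coord ?y F = (if F \<in> faces K i then coord x F else 0)" for F
    using weight_pos[of F i] by (cases "F \<in> faces K i") (simp_all add: coord_ell2_of[OF cochain_of_in_l2] cochain_of_def)
  have "(norm ?y)\<^sup>2 \<le> (norm x)\<^sup>2"
    unfolding norm_ell2_square by (intro infsum_mono square_summable_coord) (simp add: c)
  then show ?thesis by (rule power2_le_imp_le) simp
qed

section \<open>Transported operators, their adjoints and exponentials\<close>

lemma app_transport:
  assumes "l2_bounded_op K w i j T"
  shows "app (transport K w i T) x = ell2_of w (T (cochain_of K w i x))"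
  unfolding transport_def
proof (rule app_blop_of)
  have T: "T f \<in> l2 K w j" if "f \<in> l2 K w i" for f
    using assms that unfolding l2_bounded_op_def by blast
  have comb: "ell2_of w (T (cochain_of K w i (a *\<^sub>R x + b *\<^sub>R y))) =
      a *\<^sub>R ell2_of w (T (cochain_of K w i x)) + b *\<^sub>R ell2_of w (T (cochain_of K w i y))" for a b x y
    by (simp add: cochain_of_linear_combination l2_bounded_op_linear[OF assms] l2_linear_combination(2)[OF T T] cochain_of_in_l2)
  obtain C where C: "\<And>f. f \<in> l2 K w i \<Longrightarrow> l2_norm K w j (T f) \<le> C * l2_norm K w i f"
    using assms unfolding l2_bounded_op_def by blast
  show "bounded_linear (\<lambda>x. ell2_of w (T (cochain_of K w i x)))"
  proof
    show "ell2_of w (T (cochain_of K w i (x + y))) = ell2_of w (T (cochain_of K w i x)) + ell2_of w (T (cochain_of K w i y))" for x y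
      using comb[of 1 x 1 y] by simp
    show "ell2_of w (T (cochain_of K w i (r *\<^sub>R x))) = r *\<^sub>R ell2_of w (T (cochain_of K w i x))" for r x
      using comb[of r x 0 0] by simp
    have "norm (ell2_of w (T (cochain_of K w i x))) \<le> norm x * \<bar>C\<bar>" for x
    proof -
      have "norm (ell2_of w (T (cochain_of K w i x))) \<le> C * norm (ell2_of w (cochain_of K w i x))"
        using C[OF cochain_of_in_l2[of i x]] by (simp add: l2_norm_ell2_of T cochain_of_in_l2)
      also have "\<dots> \<le> \<bar>C\<bar> * norm x"
        by (intro mult_mono norm_ell2_of_cochain_of_le) auto
      finally show ?thesis by (simp add: mult.commute)
    qed
    then show "\<exists>B. \<forall>x. norm (ell2_of w (T (cochain_of K w i x))) \<le> norm x * B" by blast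
  qed
qed

lemma l2_bounded_op_zero:
  assumes "l2_bounded_op K w i j T"
  shows "T (\<lambda>_. 0) = (\<lambda>_. 0)"
  using l2_bounded_op_linear[OF assms l2_zero(1) l2_zero(1), of 0 0] by simp

lemma transport_ell2_of:
  "l2_bounded_op K w i j T \<Longrightarrow> f \<in> l2 K w i \<Longrightarrow> app (transport K w i T) (ell2_of w f) = ell2_of w (T f)"
  by (simp add: app_transport cochain_of_ell2_of)

lemma transport_supported:
  "l2_bounded_op K w i j T \<Longrightarrow> app (transport K w i T) x \<in> supported (faces K j)"
  by (simp add: app_transport ell2_of_in_supported l2_bounded_op_closed cochain_of_in_l2)

text \<open>The transported operator kills \<open>unit F\<close> for every F that is not an i-face,
  and the coordinate of an adjoint image at F is an inner product with that vanishing vector. Hence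
  adjoint images are again cochains.\<close>

lemma adj_transport_supported:
  assumes "l2_bounded_op K w i j T"
  shows "app (adj (transport K w i T)) x \<in> supported (faces K i)"
proof -
  have "coord (app (adj (transport K w i T)) x) F = 0" if "F \<notin> faces K i" for F
  proof -
    have "cochain_of K w i (unit F) = (\<lambda>_. 0)"
      using that by (auto simp: cochain_of_def coord_unit fun_eq_iff)
    then have "app (transport K w i T) (unit F) = 0"
      by (simp add: app_transport[OF assms] l2_bounded_op_zero[OF assms] l2_zero)
    then show ?thesis
      using inner_app_left[of "transport K w i T" "unit F" x] by simp
  qed
  then show ?thesis by (simp add: supported_def)
qed

lemma l2_adjoint_ell2_of:
  assumes T: "l2_bounded_op K w i j T" and g: "g \<in> l2 K w j"
  shows "l2_adjoint K w i j T g \<in> l2 K w i"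
    and "ell2_of w (l2_adjoint K w i j T g) = app (adj (transport K w i T)) (ell2_of w g)"
proof -
  define h where "h = cochain_of K w i (app (adj (transport K w i T)) (ell2_of w g))"
  have h: "h \<in> l2 K w i" "ell2_of w h = app (adj (transport K w i T)) (ell2_of w g)"
    unfolding h_def by (auto intro: cochain_of_in_l2 ell2_of_cochain_of adj_transport_supported[OF T])
  have "l2_adjoint K w i j T g = h"
    unfolding l2_adjoint_def
  proof (rule the_equality)
    show "h \<in> l2 K w i \<and> (\<forall>f\<in>l2 K w i. l2_inner K w j (T f) g = l2_inner K w i f h)"
      using h g l2_bounded_op_closed[OF T]
      by (simp add: l2_inner_ell2_of transport_ell2_of[OF T, symmetric] inner_app_left)
    fix h' assume h': "h' \<in> l2 K w i \<and> (\<forall>f\<in>l2 K w i. l2_inner K w j (T f) g = l2_inner K w i f h')"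
    have "ell2_of w f \<bullet> (ell2_of w h' - ell2_of w h) = 0" if "f \<in> l2 K w i" for f
    proof -
      have "ell2_of w f \<bullet> ell2_of w h' = ell2_of w (T f) \<bullet> ell2_of w g"
      proof -
        have "l2_inner K w j (T f) g = l2_inner K w i f h'" "h' \<in> l2 K w i" using h' that by auto
        then show ?thesis
          using l2_inner_ell2_of[OF that] l2_inner_ell2_of[OF l2_bounded_op_closed[OF T that] g] by simp
      qed
      also have "\<dots> = ell2_of w f \<bullet> ell2_of w h"
        using that by (simp add: transport_ell2_of[OF T, symmetric] inner_app_left h(2))
      finally show ?thesis by (simp add: inner_diff_right)
    qed
    \<comment> \<open>Taking the difference h' - h itself as test vector shows that its norm is 0,
      which is the uniqueness demanded by the definite description.\<close>
    from this[OF l2_diff(1)[OF _ h(1), of h' 1]] l2_diff(2)[OF _ h(1), of h' 1] h'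
    have "ell2_of w h' = ell2_of w h" by simp
    with h' h(1) show "h' = h" by (auto intro: ell2_of_inject)
  qed
  with h show "l2_adjoint K w i j T g \<in> l2 K w i"
    "ell2_of w (l2_adjoint K w i j T g) = app (adj (transport K w i T)) (ell2_of w g)" by simp_all
qed

text \<open>The partial sums correspond term by term to those of \<open>exp A\<close>, and the
  correspondence preserves norms. The definite description therefore picks the cochain of the
  Banach-algebra limit.\<close>

lemma l2_exp_ell2_of:
  assumes T: "represents K w i A T" and f: "f \<in> l2 K w i"
  shows "l2_exp K w i T f \<in> l2 K w i"
    and "ell2_of w (l2_exp K w i T f) = app (exp A) (ell2_of w f)"
proof -
  have pow: "(T ^^ k) f \<in> l2 K w i \<and> ell2_of w ((T ^^ k) f) = app (A ^ k) (ell2_of w f)" for k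
    by (induction k) (simp_all add: f representsD[OF T])
  have part: "(\<lambda>F. \<Sum>k<n. (T ^^ k) f F / fact k) \<in> l2 K w i \<and>
      ell2_of w (\<lambda>F. \<Sum>k<n. (T ^^ k) f F / fact k) = (\<Sum>k<n. app (A ^ k) (ell2_of w f) /\<^sub>R fact k)" for n
  proof (induction n)
    case (Suc n)
    show ?case
      using l2_linear_combination[of "\<lambda>F. \<Sum>k<n. (T ^^ k) f F / fact k" i "(T ^^ n) f" 1 "inverse (fact n)"]
        Suc pow[of n] by (simp add: divide_inverse mult.commute)
  qed (simp add: l2_zero)
  have lim: "(\<lambda>n. \<Sum>k<n. app (A ^ k) (ell2_of w f) /\<^sub>R fact k) \<longlonglongrightarrow> app (exp A) (ell2_of w f)"
    using sums_app_exp unfolding sums_def .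
  \<comment> \<open>A coordinate is a continuous functional and vanishes on all partial sums off the
    i-faces, so the limit still comes from a cochain.\<close>
  have "app (exp A) (ell2_of w f) \<in> supported (faces K i)"
    unfolding supported_def
  proof (intro CollectI allI impI)
    fix F assume F: "F \<notin> faces K i"
    have "ell2_of w ((T ^^ k) f) \<in> supported (faces K i)" for k
      using pow ell2_of_in_supported by blast
    then have "coord (\<Sum>k<n. app (A ^ k) (ell2_of w f) /\<^sub>R fact k) F = 0" for n
      using F pow by (simp add: coord_sum supported_def)
    then show "coord (app (exp A) (ell2_of w f)) F = 0"
      using tendsto_inner[OF lim tendsto_const[of "unit F"]] by (simp add: LIMSEQ_const_iff)
  qed
  then obtain g where g: "g \<in> l2 K w i" "ell2_of w g = app (exp A) (ell2_of w f)"
    using cochain_of_in_l2 ell2_of_cochain_of by blast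
  have norm_eq: "l2_norm K w i (\<lambda>F. (\<Sum>k<n. (T ^^ k) f F / fact k) - h F) =
      norm ((\<Sum>k<n. app (A ^ k) (ell2_of w f) /\<^sub>R fact k) - ell2_of w h)" if "h \<in> l2 K w i" for h n
    using l2_diff[of "\<lambda>F. \<Sum>k<n. (T ^^ k) f F / fact k" i h 1] part[of n] that
    by (simp add: l2_norm_ell2_of)
  have "l2_exp K w i T f = g"
    unfolding l2_exp_def
  proof (rule the_equality)
    show "g \<in> l2 K w i \<and>
        (\<lambda>n. l2_norm K w i (\<lambda>F. (\<Sum>k<n. (T ^^ k) f F / fact k) - g F)) \<longlonglongrightarrow> 0"
      using g lim by (simp add: norm_eq tendsto_norm_zero_iff LIM_zero_iff)
    fix h assume h: "h \<in> l2 K w i \<and>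
        (\<lambda>n. l2_norm K w i (\<lambda>F. (\<Sum>k<n. (T ^^ k) f F / fact k) - h F)) \<longlonglongrightarrow> 0"
    then have "(\<lambda>n. norm ((\<Sum>k<n. app (A ^ k) (ell2_of w f) /\<^sub>R fact k) - ell2_of w h)) \<longlonglongrightarrow> 0"
      using norm_eq[of h] by simp
    then have "(\<lambda>n. \<Sum>k<n. app (A ^ k) (ell2_of w f) /\<^sub>R fact k) \<longlonglongrightarrow> ell2_of w h"
      by (rule LIM_zero_cancel[OF tendsto_norm_zero_cancel])
    then have "ell2_of w h = ell2_of w g"
      using lim g(2) LIMSEQ_unique by fastforce
    with h g(1) show "h = g" by (auto intro: ell2_of_inject)
  qed
  with g show "l2_exp K w i T f \<in> l2 K w i" "ell2_of w (l2_exp K w i T f) = app (exp A) (ell2_of w f)"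
    by simp_all
qed

end

section \<open>The bottom of the spectrum\<close>

text \<open>Turns a vector on which a nonnegative form is small into one that the operator nearly
  annihilates. The set \<open>S\<close> is there because the shifted operator used below is known to
  be nonnegative only on the cochains.\<close>

lemma norm_square_le_quadratic_form:
  fixes A :: "'v::{real_inner, perfect_space} blop"
  assumes sym: "\<And>x y. app A x \<bullet> y = x \<bullet> app A y"
    and nonneg: "\<And>x. x \<in> S \<Longrightarrow> 0 \<le> app A x \<bullet> x"
    and closed: "\<And>x c. x \<in> S \<Longrightarrow> x - c *\<^sub>R app A x \<in> S" and x: "x \<in> S"
  shows "(norm (app A x))\<^sup>2 \<le> (norm A + 1) * (app A x \<bullet> x)"
proof -
  define N where "N = norm A + 1"
  have N: "N > 0" unfolding N_def using norm_ge_zero[of A] by linarith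
  define y where "y = app A x"
  have yy: "y \<bullet> y = (norm y)\<^sup>2" by (simp add: power2_norm_eq_inner)
  have "app A y \<bullet> y \<le> norm (app A y) * norm y" by (rule norm_cauchy_schwarz)
  also have "\<dots> \<le> norm A * norm y * norm y" by (intro mult_right_mono norm_app_le) simp
  also have "\<dots> \<le> N * (norm y)\<^sup>2" by (simp add: N_def power2_eq_square distrib_right)
  finally have Ay: "app A y \<bullet> y \<le> N * (norm y)\<^sup>2" .
  \<comment> \<open>A gradient step of length 1 / N from x: the quadratic term uses up at most half
    of the linear gain, leaving the form at x minus norm y ^ 2 / N. The summand 1 in N keeps the
    divisor positive.\<close>
  have "0 \<le> app A (x - (1 / N) *\<^sub>R y) \<bullet> (x - (1 / N) *\<^sub>R y)"
    unfolding y_def by (intro nonneg closed x)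
  also have "\<dots> = app A x \<bullet> x - 2 / N * (norm y)\<^sup>2 + (1 / N)\<^sup>2 * (app A y \<bullet> y)"
    by (simp add: app.diff_right app.scaleR_right inner_diff_left inner_diff_right sym[of y x]
        y_def[symmetric] yy power2_eq_square inner_commute[of x y] algebra_simps)
  also have "\<dots> \<le> app A x \<bullet> x - 2 / N * (norm y)\<^sup>2 + (1 / N)\<^sup>2 * (N * (norm y)\<^sup>2)"
    by (intro add_left_mono mult_left_mono Ay) simp
  also have "\<dots> = app A x \<bullet> x - (norm y)\<^sup>2 / N"
    using N by (simp add: power2_eq_square field_simps)
  finally show ?thesis using N unfolding y_def N_def by (simp add: field_simps)
qed

lemma supported_combination:
  "x \<in> supported X \<Longrightarrow> y \<in> supported X \<Longrightarrow> a *\<^sub>R x + b *\<^sub>R y \<in> supported X"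
  by (simp add: supported_def)

lemma supported_diff_scaleR: "x \<in> supported X \<Longrightarrow> y \<in> supported X \<Longrightarrow> x - b *\<^sub>R y \<in> supported X"
  by (simp add: supported_def)

context
  fixes K :: "'a set set" and w :: "'a set \<Rightarrow> real"
  assumes weighted: "weighted_complex K w"
begin

text \<open>An inverse in the whole operator algebra must be shown to preserve cochains. Solving A R
  x - \<mu> R x = x for R x does this, since the range of \<open>A\<close> is supported on the
  faces; the division explains the condition on \<mu>.\<close>

lemma resolvent_of_inverse:
  assumes T: "represents K w i A T" and A: "\<And>x. app A x \<in> supported (faces K i)"
    and inv: "R * (A - \<mu> *\<^sub>R 1) = 1" "(A - \<mu> *\<^sub>R 1) * R = 1" and "\<mu> \<noteq> 0"
  shows "\<mu> \<notin> l2_spectrum K w i T"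
proof -
  have RA: "app R (app A x - \<mu> *\<^sub>R x) = x" for x
    using arg_cong[OF inv(1), of "\<lambda>B. app B x"] by (simp add: app.diff_left app.scaleR_left)
  have AR: "app A (app R x) - \<mu> *\<^sub>R app R x = x" for x
    using arg_cong[OF inv(2), of "\<lambda>B. app B x"] by (simp add: app.diff_left app.scaleR_left)
  have supp: "app R x \<in> supported (faces K i)" if "x \<in> supported (faces K i)" for x
  proof -
    have "app R x = (1 / \<mu>) *\<^sub>R app A (app R x) + (- 1 / \<mu>) *\<^sub>R x"
      using arg_cong[OF AR[of x], of "\<lambda>y. (1 / \<mu>) *\<^sub>R y"] \<open>\<mu> \<noteq> 0\<close> by (simp add: algebra_simps)
    then show ?thesis using supported_combination[OF A that] by metis
  qed
  define R' where "R' f = cochain_of K w i (app R (ell2_of w f))" for f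
  have R': "R' f \<in> l2 K w i" "ell2_of w (R' f) = app R (ell2_of w f)" if "f \<in> l2 K w i" for f
    unfolding R'_def using that
    by (auto intro: cochain_of_in_l2[OF weighted] ell2_of_cochain_of[OF weighted] supp
        ell2_of_in_supported[OF weighted])
  have "l2_bounded_op K w i i R'"
    unfolding l2_bounded_op_def
  proof (intro conjI ballI allI)
    show "R' f \<in> l2 K w i" if "f \<in> l2 K w i" for f using R'(1)[OF that] .
    show "R' (\<lambda>F. a * f F + b * g F) = (\<lambda>F. a * R' f F + b * R' g F)"
      if "f \<in> l2 K w i" "g \<in> l2 K w i" for f g a b
      using l2_linear_combination(2)[OF weighted that]
      by (simp add: R'_def app.add_right app.scaleR_right cochain_of_linear_combination)
    have "l2_norm K w i (R' f) \<le> norm R * l2_norm K w i f" if "f \<in> l2 K w i" for f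
      using norm_app_le R' that by (simp add: l2_norm_ell2_of[OF weighted])
    then show "\<exists>C. \<forall>f\<in>l2 K w i. l2_norm K w i (R' f) \<le> C * l2_norm K w i f" by blast
  qed
  moreover have "R' (\<lambda>F. T f F - \<mu> * f F) = f" if "f \<in> l2 K w i" for f
    using l2_diff(2)[OF weighted representsD(1)[OF T that] that] that
    by (simp add: R'_def representsD(2)[OF T that] RA cochain_of_ell2_of[OF weighted])
  moreover have "(\<lambda>F. T (R' f) F - \<mu> * R' f F) = f" if f: "f \<in> l2 K w i" for f
  proof (rule ell2_of_inject[OF weighted _ f])
    note TR = representsD[OF T R'(1)[OF f]]
    show "(\<lambda>F. T (R' f) F - \<mu> * R' f F) \<in> l2 K w i"
      by (rule l2_diff(1)[OF weighted TR(1) R'(1)[OF f]])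
    show "ell2_of w (\<lambda>F. T (R' f) F - \<mu> * R' f F) = ell2_of w f"
      using l2_diff(2)[OF weighted TR(1) R'(1)[OF f]] by (simp add: TR(2) R'(2)[OF f] AR)
  qed
  ultimately show ?thesis unfolding l2_spectrum_def by blast
qed

text \<open>Needed before \<open>Inf\<close> of the spectrum can be compared with its elements.
  Below -norm A the Neumann series for A / \<mu> supplies the inverse.\<close>

lemma l2_spectrum_bdd_below:
  assumes T: "represents K w i A T" and A: "\<And>x. app A x \<in> supported (faces K i)"
  shows "bdd_below (l2_spectrum K w i T)"
proof (rule bdd_belowI)
  fix \<mu> assume \<mu>: "\<mu> \<in> l2_spectrum K w i T"
  show "- norm A \<le> \<mu>"
  proof (rule ccontr)
    assume "\<not> - norm A \<le> \<mu>"
    then have less: "norm A < - \<mu>" by simp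
    then have neg: "\<mu> < 0" using norm_ge_zero[of A] by linarith
    have "norm ((1 / \<mu>) *\<^sub>R A) < 1" using less neg by (simp add: field_simps)
    then obtain S where S: "S * (1 - (1 / \<mu>) *\<^sub>R A) = 1" "(1 - (1 / \<mu>) *\<^sub>R A) * S = 1"
      by (rule one_minus_invertible)
    have "A - \<mu> *\<^sub>R 1 = (- \<mu>) *\<^sub>R (1 - (1 / \<mu>) *\<^sub>R A)" using neg by (simp add: algebra_simps)
    then have "(- 1 / \<mu>) *\<^sub>R S * (A - \<mu> *\<^sub>R 1) = 1" "(A - \<mu> *\<^sub>R 1) * (- 1 / \<mu>) *\<^sub>R S = 1"
      using S neg by simp_all
    with T A have "\<mu> \<notin> l2_spectrum K w i T" by (rule resolvent_of_inverse) (use neg in simp)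
    with \<mu> show False by simp
  qed
qed

text \<open>The infimum of the numerical range is an approximate eigenvalue.\<close>

lemma Inf_numerical_range_in_spectrum:
  assumes T: "represents K w i A T" and A: "\<And>x. app A x \<in> supported (faces K i)"
    and sym: "\<And>x y. app A x \<bullet> y = x \<bullet> app A y" and ne: "faces K i \<noteq> {}"
  defines "m \<equiv> Inf ((\<lambda>x. app A x \<bullet> x) ` {x \<in> supported (faces K i). norm x = 1})"
  shows "m \<in> l2_spectrum K w i T"
    and "x \<in> supported (faces K i) \<Longrightarrow> m * (norm x)\<^sup>2 \<le> app A x \<bullet> x"
proof -
  define U where "U = {x \<in> supported (faces K i). norm x = 1}"
  have "U \<noteq> {}"
  proof -
    obtain F where "F \<in> faces K i" using ne by blast
    then have "unit F \<in> U" by (auto simp: U_def supported_def coord_unit)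
    then show ?thesis by blast
  qed
  have "bdd_below ((\<lambda>x. app A x \<bullet> x) ` U)"
  proof (rule bdd_belowI2)
    fix x assume "x \<in> U"
    then show "- norm A \<le> app A x \<bullet> x"
      using Cauchy_Schwarz_ineq2[of "app A x" x] norm_app_le[of A x] by (simp add: U_def)
  qed
  then have m_le: "m \<le> app A x \<bullet> x" if "x \<in> U" for x
    using that unfolding m_def U_def by (auto intro: cInf_lower)
  show lower: "m * (norm x)\<^sup>2 \<le> app A x \<bullet> x" if x: "x \<in> supported (faces K i)" for x
  proof (cases "x = 0")
    case False
    have "(1 / norm x) *\<^sub>R x \<in> U" using False x by (simp add: U_def supported_def)
    from m_le[OF this] show ?thesis
      using False by (simp add: app.scaleR_right power2_eq_square field_simps)
  qed (simp add: app.zero_right)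
  show "m \<in> l2_spectrum K w i T"
  proof (rule ccontr)
    assume "m \<notin> l2_spectrum K w i T"
    then obtain R where R: "l2_bounded_op K w i i R"
      "\<And>f. f \<in> l2 K w i \<Longrightarrow> R (\<lambda>F. T f F - m * f F) = f"
      unfolding l2_spectrum_def by blast
    then obtain C where C: "\<And>f. f \<in> l2 K w i \<Longrightarrow> l2_norm K w i (R f) \<le> C * l2_norm K w i f"
      unfolding l2_bounded_op_def by blast
    define Am where "Am = A - m *\<^sub>R 1"
    have Am: "app Am x = app A x - m *\<^sub>R x" for x
      unfolding Am_def by (simp add: app.diff_left app.scaleR_left)
    define N where "N = norm Am + 1"
    have N: "N > 0" unfolding N_def using norm_ge_zero[of Am] by linarith
    \<comment> \<open>A bounded resolvent keeps norm (app Am x) away from 0 on unit vectors. As the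
      square of this norm is at most N times the form of \<open>Am\<close>, the form of
      \<open>A\<close> stays away from \<open>m\<close> as well.\<close>
    have gap: "1 \<le> C\<^sup>2 * N * (app A x \<bullet> x - m)" if "x \<in> U" for x
    proof -
      have x: "x \<in> supported (faces K i)" "norm x = 1" using that by (auto simp: U_def)
      define f where "f = cochain_of K w i x"
      have f: "f \<in> l2 K w i" "ell2_of w f = x"
        unfolding f_def using x by (auto intro: cochain_of_in_l2[OF weighted] ell2_of_cochain_of[OF weighted])
      note Tf = representsD[OF T f(1)]
      have "1 = l2_norm K w i (R (\<lambda>F. T f F - m * f F))"
        using R(2)[OF f(1)] f x by (simp add: l2_norm_ell2_of[OF weighted])
      also have "\<dots> \<le> C * norm (app Am x)"
        using C[OF l2_diff(1)[OF weighted Tf(1) f(1), of m]] l2_diff[OF weighted Tf(1) f(1), of m]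
        by (simp add: l2_norm_ell2_of[OF weighted] Tf(2) f(2) Am)
      finally have "1 \<le> (C * norm (app Am x))\<^sup>2" by (rule one_le_power)
      also have "\<dots> = C\<^sup>2 * (norm (app Am x))\<^sup>2" by (simp add: power_mult_distrib)
      also have "\<dots> \<le> C\<^sup>2 * (N * (app Am x \<bullet> x))"
        unfolding N_def
      proof (intro mult_left_mono norm_square_le_quadratic_form[where S = "supported (faces K i)"] x)
        show "app Am y \<bullet> z = y \<bullet> app Am z" for y z
          by (simp add: Am inner_diff_left inner_diff_right sym)
        show "0 \<le> app Am y \<bullet> y" if "y \<in> supported (faces K i)" for y
          using lower[OF that] by (simp add: Am inner_diff_left power2_norm_eq_inner)
        show "y - c *\<^sub>R app Am y \<in> supported (faces K i)" if "y \<in> supported (faces K i)" for y c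
          unfolding Am by (intro supported_diff_scaleR that A)
      qed simp
      finally show ?thesis
        using x(2) by (simp add: Am inner_diff_left mult.assoc norm_eq_1)
    qed
    have "C\<^sup>2 * N > 0"
    proof (rule ccontr)
      assume "\<not> ?thesis"
      moreover have "C\<^sup>2 * N \<ge> 0" using N by simp
      ultimately have "C\<^sup>2 * N = 0" by linarith
      then show False using gap \<open>U \<noteq> {}\<close> by fastforce
    qed
    then have "1 / (C\<^sup>2 * N) \<le> app A x \<bullet> x - m" if "x \<in> U" for x
      using gap[OF that] by (simp only: pos_divide_le_eq mult.commute)
    \<comment> \<open>A lower bound on the numerical range that exceeds its infimum: the
      contradiction.\<close>
    then have "m + 1 / (C\<^sup>2 * N) \<le> app A x \<bullet> x" if "x \<in> U" for x
      using that by fastforce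
    then have "m + 1 / (C\<^sup>2 * N) \<le> m"
      unfolding m_def U_def[symmetric] using \<open>U \<noteq> {}\<close> by (intro cInf_greatest) auto
    with \<open>C\<^sup>2 * N > 0\<close> show False by simp
  qed
qed

lemma Inf_spectrum_le_form:
  assumes T: "represents K w i A T" and A: "\<And>x. app A x \<in> supported (faces K i)"
    and sym: "\<And>x y. app A x \<bullet> y = x \<bullet> app A y" and ne: "faces K i \<noteq> {}"
    and x: "x \<in> supported (faces K i)"
  shows "Inf (l2_spectrum K w i T) * (norm x)\<^sup>2 \<le> app A x \<bullet> x"
proof -
  note m = Inf_numerical_range_in_spectrum[OF T A sym ne]
  have "Inf (l2_spectrum K w i T) \<le> Inf ((\<lambda>x. app A x \<bullet> x) ` {x \<in> supported (faces K i). norm x = 1})"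
    by (rule cInf_lower[OF m(1) l2_spectrum_bdd_below[OF T A]])
  from mult_right_mono[OF this, of "(norm x)\<^sup>2"] m(2)[OF x] show ?thesis by simp
qed

section \<open>The Hodge Laplacian\<close>

text \<open>Assembled from transported coboundaries and their adjoints, so that boundedness is built
  in and the form splits into an up and a down part.\<close>

definition laplace_op :: "('a set \<Rightarrow> 'a list set) \<Rightarrow> int \<Rightarrow> 'a set ell2 blop" where
  "laplace_op ori i =
    (let D = transport K w i (coboundary K ori i); E = transport K w (i - 1) (coboundary K ori (i - 1))
     in adj D * D + E * adj E)"

context
  fixes ori :: "'a set \<Rightarrow> 'a list set" and i :: int
  assumes bounded: "hodge_laplacian_bounded K w ori i"
begin

lemma coboundary_bounded:
  "l2_bounded_op K w i (i + 1) (coboundary K ori i)"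
  "l2_bounded_op K w (i - 1) i (coboundary K ori (i - 1))"
  using bounded by (auto simp: hodge_laplacian_bounded_def)

lemma laplace_op_represents: "represents K w i (laplace_op ori i) (hodge_laplacian K w ori i)"
  unfolding represents_def
proof
  fix f assume f: "f \<in> l2 K w i"
  define f1 where "f1 = l2_adjoint K w i (i + 1) (coboundary K ori i) (coboundary K ori i f)"
  define f2 where "f2 = coboundary K ori (i - 1) (l2_adjoint K w (i - 1) i (coboundary K ori (i - 1)) f)"
  note b = coboundary_bounded
  note a1 = l2_adjoint_ell2_of[OF weighted b(1) l2_bounded_op_closed[OF b(1) f]]
  note a2 = l2_adjoint_ell2_of[OF weighted b(2) f]
  have f12: "f1 \<in> l2 K w i" "f2 \<in> l2 K w i"
    unfolding f1_def f2_def using a1(1) l2_bounded_op_closed[OF b(2) a2(1)] .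
  have "hodge_laplacian K w ori i f = (\<lambda>F. 1 * f1 F + 1 * f2 F)"
    by (rule ext) (simp add: hodge_laplacian_def f1_def f2_def)
  then show "hodge_laplacian K w ori i f \<in> l2 K w i \<and>
      ell2_of w (hodge_laplacian K w ori i f) = app (laplace_op ori i) (ell2_of w f)"
    using l2_linear_combination[OF weighted f12, of 1 1] a1(2) a2(2)
      transport_ell2_of[OF weighted b(1) f] transport_ell2_of[OF weighted b(2) a2(1)]
    by (simp add: f1_def f2_def laplace_op_def app.add_left Let_def)
qed

lemma laplace_op_supported: "app (laplace_op ori i) x \<in> supported (faces K i)"
proof -
  have "app (adj (transport K w i (coboundary K ori i))) y \<in> supported (faces K i)" for y
    by (rule adj_transport_supported[OF weighted coboundary_bounded(1)])
  moreover have "app (transport K w (i - 1) (coboundary K ori (i - 1))) y \<in> supported (faces K i)" for y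
    by (rule transport_supported[OF weighted coboundary_bounded(2)])
  ultimately show ?thesis
    by (simp add: laplace_op_def Let_def app.add_left supported_def)
qed

text \<open>Each adjoint moves to the other side. The entries become inner products of columns, and
  the two summands will match \<open>w_up\<close> and \<open>w_down\<close>.\<close>

lemma inner_laplace_op:
  defines "D \<equiv> transport K w i (coboundary K ori i)"
    and "E \<equiv> transport K w (i - 1) (coboundary K ori (i - 1))"
  shows "app (laplace_op ori i) x \<bullet> y = app D x \<bullet> app D y + app (adj E) x \<bullet> app (adj E) y"
proof -
  have "app (adj D) (app D x) \<bullet> y = app D x \<bullet> app D y"
    using inner_app_left[of D y "app D x"] by (simp add: inner_commute)
  moreover have "app E (app (adj E) x) \<bullet> y = app (adj E) x \<bullet> app (adj E) y"
    by (rule inner_app_left)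
  ultimately show ?thesis
    by (simp add: laplace_op_def Let_def app.add_left inner_add_left D_def E_def)
qed

lemma laplace_op_sym: "app (laplace_op ori i) x \<bullet> y = x \<bullet> app (laplace_op ori i) y"
  by (simp add: inner_laplace_op inner_commute[of x])  (simp add: inner_commute)

end

end

section \<open>Matrix entries of the Hodge Laplacian\<close>

lemma inner_ell2_single:
  assumes "\<And>y. y \<noteq> z \<Longrightarrow> coord f y * coord g y = 0"
  shows "f \<bullet> g = coord f z * coord g z"
proof -
  have "f \<bullet> g = (\<Sum>\<^sub>\<infinity>y\<in>{z}. coord f y * coord g y)"
    unfolding inner_ell2.rep_eq using assms by (intro infsum_cong_neutral) auto
  then show ?thesis by simp
qed

lemma incidence_eq_0: "F \<notin> bdry K G \<Longrightarrow> incidence K ori F G = 0"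
  by (simp add: incidence_def)

lemma abs_incidence_le_1: "\<bar>incidence K ori F G\<bar> \<le> 1"
  by (simp add: incidence_def Let_def abs_mult power_abs)

text \<open>Distinct faces of equal size have a union with at least one extra vertex, which already
  exhausts G. Two columns of the coboundary therefore overlap in at most one row.\<close>

lemma bdry_Un:
  assumes "F \<in> bdry K G" "F' \<in> bdry K G" "F \<noteq> F'" "finite G"
  shows "G = F \<union> F'"
proof -
  have sub: "F \<union> F' \<subseteq> G" "card G = card F + 1" "card F = card F'"
    using assms by (auto simp: bdry_def)
  have fin: "finite (F \<union> F')" using sub(1) assms(4) by (rule finite_subset)
  have "F \<subset> F \<union> F'"
    using card_subset_eq[of F F'] card_subset_eq[of F' F] sub(3) fin assms(3) by auto
  then have "card F < card (F \<union> F')" using fin by (intro psubset_card_mono)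
  then show ?thesis
    using card_seteq[OF assms(4) sub(1)] sub(2) by simp
qed

text \<open>Dually, the intersection loses at least one vertex of F, so it cannot exceed H; this
  leaves a single overlap in the down part.\<close>

lemma bdry_Int:
  assumes "H \<in> bdry K F" "H \<in> bdry K F'" "F \<noteq> F'" "finite F" "finite F'"
  shows "H = F \<inter> F'"
proof -
  have sub: "H \<subseteq> F \<inter> F'" "card F = card H + 1" "card F = card F'"
    using assms by (auto simp: bdry_def)
  have "F \<inter> F' \<subset> F"
    using card_subset_eq[of F F'] card_subset_eq[of F' F] sub(3) assms(3-5) by auto
  then have "card (F \<inter> F') < card F" using assms(4) by (intro psubset_card_mono)
  then show ?thesis
    using card_seteq[of "F \<inter> F'" H] sub(1,2) assms(4) by simp
qed

context
  fixes V :: "'a set" and K :: "'a set set" and w :: "'a set \<Rightarrow> real"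
  assumes complex: "abstract_complex V K" and weighted: "weighted_complex K w"
begin

lemma face_finite: "F \<in> faces K i \<Longrightarrow> finite F"
  using complex by (auto simp: abstract_complex_def faces_def)

lemma coord_transport_coboundary:
  assumes T: "l2_bounded_op K w j (j + 1) (coboundary K ori j)" and H: "H \<in> faces K j"
  shows "coord (app (transport K w j (coboundary K ori j)) (unit H)) G =
    (if G \<in> faces K (j + 1) then incidence K ori H G * sqrt (w G) / sqrt (w H) else 0)"
proof -
  have e: "cochain_of K w j (unit H) F = (if F = H then 1 / sqrt (w H) else 0)" for F
    using H by (simp add: cochain_of_def coord_unit)
  have "coboundary K ori j (cochain_of K w j (unit H)) G = incidence K ori H G / sqrt (w H)"
    if "G \<in> faces K (j + 1)"
  proof -
    have "finite (bdry K G)"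
      by (rule finite_subset[of _ "Pow G"]) (use face_finite[OF that] in \<open>auto simp: bdry_def\<close>)
    then show ?thesis
      using that by (simp add: coboundary_def e if_distrib sum.delta incidence_eq_0 cong: if_cong)
  qed
  moreover have "coboundary K ori j (cochain_of K w j (unit H)) G = 0" if "G \<notin> faces K (j + 1)"
    using that by (simp add: coboundary_def)
  ultimately show ?thesis
    by (simp add: app_transport[OF weighted T]
        coord_ell2_of[OF weighted l2_bounded_op_closed[OF T cochain_of_in_l2[OF weighted]]])
qed

text \<open>Weights are constrained on faces only, so the sign of the up part requires identifying
  the union with the common coface.\<close>

lemma w_pair_nonneg: "F \<in> faces K i \<Longrightarrow> F' \<in> faces K i \<Longrightarrow> 0 \<le> w_pair K w i F F'"
proof -
  assume F: "F \<in> faces K i" "F' \<in> faces K i"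
  have "0 \<le> w (F \<union> F')" if "\<exists>G\<in>faces K (i + 1). F \<in> bdry K G \<and> F' \<in> bdry K G" "F \<noteq> F'"
    using that bdry_Un face_finite weight_pos[OF weighted] by (metis less_imp_le)
  moreover have "0 \<le> w F * w F' / w (F \<inter> F')" if "F \<inter> F' \<in> faces K (i - 1)"
    using that F weight_pos[OF weighted] by (intro divide_nonneg_nonneg mult_nonneg_nonneg) (auto intro: less_imp_le)
  ultimately show ?thesis
    by (auto simp: w_pair_def w_up_def w_down_def)
qed

text \<open>The up part reduces to its coordinate at F \<union> F' and the down part to the one at F
  \<inter> F'. There the rescaled columns multiply to w (F \<union> F') / (sqrt (w F) sqrt (w F'))
  and to sqrt (w F) sqrt (w F') / w (F \<inter> F'), up to incidence factors of absolute value at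
  most 1.\<close>

lemma abs_laplace_op_entry_le:
  assumes bounded: "hodge_laplacian_bounded K w ori i"
    and F: "F \<in> faces K i" and F': "F' \<in> faces K i" and "F \<noteq> F'"
  shows "\<bar>coord (app (laplace_op K w ori i) (unit F)) F'\<bar> \<le> w_pair K w i F F' / (sqrt (w F) * sqrt (w F'))"
proof -
  define D where "D = transport K w i (coboundary K ori i)"
  define E where "E = transport K w (i - 1) (coboundary K ori (i - 1))"
  note b = coboundary_bounded[OF weighted bounded]
  note pos = weight_pos[OF weighted F] weight_pos[OF weighted F']
  have D: "coord (app D (unit H)) G =
      (if G \<in> faces K (i + 1) then incidence K ori H G * sqrt (w G) / sqrt (w H) else 0)"
    if "H \<in> faces K i" for H G
    unfolding D_def by (rule coord_transport_coboundary[OF b(1) that])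
  \<comment> \<open>The matrix of the adjoint is the transpose. The column formula covers only
    indices that are (i-1)-faces; elsewhere the entry vanishes because adjoint images are supported
    there.\<close>
  have E: "coord (app (adj E) (unit H)) G =
      (if G \<in> faces K (i - 1) then incidence K ori G H * sqrt (w H) / sqrt (w G) else 0)"
    if H: "H \<in> faces K i" for H G
  proof (cases "G \<in> faces K (i - 1)")
    case True
    have "coord (app (adj E) (unit H)) G = coord (app E (unit G)) H"
      using inner_app_left[of E "unit G" "unit H"] by simp
    also have "\<dots> = incidence K ori G H * sqrt (w H) / sqrt (w G)"
      unfolding E_def using coord_transport_coboundary[of "i - 1" ori G H] b(2) True H by simp
    finally show ?thesis using True by simp
  next
    case False
    then show ?thesis
      using adj_transport_supported[OF weighted b(2)] unfolding E_def by (auto simp: supported_def)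
  qed
  have up: "\<bar>app D (unit F) \<bullet> app D (unit F')\<bar> \<le> w_up K w i F F' / (sqrt (w F) * sqrt (w F'))"
  proof -
    let ?G = "F \<union> F'"
    have "app D (unit F) \<bullet> app D (unit F') = coord (app D (unit F)) ?G * coord (app D (unit F')) ?G"
    proof (rule inner_ell2_single, rule ccontr)
      fix G assume "G \<noteq> ?G" and "coord (app D (unit F)) G * coord (app D (unit F')) G \<noteq> 0"
      then have "G \<in> faces K (i + 1)" "F \<in> bdry K G" "F' \<in> bdry K G"
        using incidence_eq_0[of _ K G ori] by (auto simp: D F F' split: if_splits)
      then have "G = ?G" using \<open>F \<noteq> F'\<close> face_finite by (intro bdry_Un)
      then show False using \<open>G \<noteq> ?G\<close> by simp
    qed
    also have "\<bar>\<dots>\<bar> \<le> w_up K w i F F' / (sqrt (w F) * sqrt (w F'))"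
    proof (cases "?G \<in> faces K (i + 1) \<and> F \<in> bdry K ?G \<and> F' \<in> bdry K ?G")
      case True
      then have wG: "0 < w ?G" "w_up K w i F F' = w ?G"
        using weight_pos[OF weighted] by (auto simp: w_up_def)
      have "coord (app D (unit F)) ?G * coord (app D (unit F')) ?G =
          incidence K ori F ?G * incidence K ori F' ?G * (w ?G / (sqrt (w F) * sqrt (w F')))"
        using True wG(1) by (simp add: D F F')
      moreover have "\<bar>incidence K ori F ?G * incidence K ori F' ?G\<bar> \<le> 1"
        unfolding abs_mult by (intro mult_le_one abs_incidence_le_1) simp
      ultimately show ?thesis
        using wG pos mult_right_mono[of "\<bar>incidence K ori F ?G * incidence K ori F' ?G\<bar>" 1
            "w ?G / (sqrt (w F) * sqrt (w F'))"]
        by (simp add: abs_mult)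
    next
      case False
      then have "coord (app D (unit F)) ?G * coord (app D (unit F')) ?G = 0"
        using incidence_eq_0[of _ K ?G ori] by (auto simp: D F F')
      moreover have "0 \<le> w_up K w i F F'"
      proof (cases "\<exists>G\<in>faces K (i + 1). F \<in> bdry K G \<and> F' \<in> bdry K G")
        case True
        then obtain G where G: "G \<in> faces K (i + 1)" "F \<in> bdry K G" "F' \<in> bdry K G" by blast
        then have "G = F \<union> F'" using \<open>F \<noteq> F'\<close> face_finite by (intro bdry_Un)
        then show ?thesis using weight_pos[OF weighted G(1)] by (simp add: w_up_def)
      next
        case False
        then show ?thesis unfolding w_up_def by (subst if_not_P) auto
      qed
      ultimately show ?thesis using pos by auto
    qed
    finally show ?thesis .
  qed
  have down: "\<bar>app (adj E) (unit F) \<bullet> app (adj E) (unit F')\<bar> \<le> w_down K w i F F' / (sqrt (w F) * sqrt (w F'))"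
  proof -
    let ?H = "F \<inter> F'"
    have "app (adj E) (unit F) \<bullet> app (adj E) (unit F') =
        coord (app (adj E) (unit F)) ?H * coord (app (adj E) (unit F')) ?H"
    proof (rule inner_ell2_single, rule ccontr)
      fix H assume "H \<noteq> ?H" and "coord (app (adj E) (unit F)) H * coord (app (adj E) (unit F')) H \<noteq> 0"
      then have "H \<in> bdry K F" "H \<in> bdry K F'"
        using incidence_eq_0[of H K _ ori] by (auto simp: E F F' split: if_splits)
      then have "H = ?H" using \<open>F \<noteq> F'\<close> face_finite[OF F] face_finite[OF F'] by (intro bdry_Int)
      then show False using \<open>H \<noteq> ?H\<close> by simp
    qed
    also have "\<bar>\<dots>\<bar> \<le> w_down K w i F F' / (sqrt (w F) * sqrt (w F'))"
    proof (cases "?H \<in> faces K (i - 1)")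
      case True
      then have wH: "0 < w ?H" "w_down K w i F F' = w F * w F' / w ?H"
        using weight_pos[OF weighted] by (auto simp: w_down_def)
      have "coord (app (adj E) (unit F)) ?H * coord (app (adj E) (unit F')) ?H =
          incidence K ori ?H F * incidence K ori ?H F' * (sqrt (w F) * sqrt (w F') / w ?H)"
        using True wH(1) by (simp add: E F F')
      moreover have "\<bar>incidence K ori ?H F * incidence K ori ?H F'\<bar> \<le> 1"
        unfolding abs_mult by (intro mult_le_one abs_incidence_le_1) simp
      moreover have "w_down K w i F F' / (sqrt (w F) * sqrt (w F')) = sqrt (w F) * sqrt (w F') / w ?H"
        unfolding wH(2) using pos wH(1) by (simp add: field_simps)
      ultimately show ?thesis
        using wH pos mult_right_mono[of "\<bar>incidence K ori ?H F * incidence K ori ?H F'\<bar>" 1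
            "sqrt (w F) * sqrt (w F') / w ?H"]
        by (simp add: abs_mult)
    next
      case False
      then show ?thesis by (simp add: E F w_down_def)
    qed
    finally show ?thesis .
  qed
  have "coord (app (laplace_op K w ori i) (unit F)) F' =
      app D (unit F) \<bullet> app D (unit F') + app (adj E) (unit F) \<bullet> app (adj E) (unit F')"
    using inner_laplace_op[OF weighted bounded, of "unit F" "unit F'"] by (simp add: D_def E_def)
  then show ?thesis
    using up down \<open>F \<noteq> F'\<close> by (simp add: w_pair_def add_divide_distrib)
qed

text \<open>The initial cochain corresponds to \<open>unit F'\<close> divided by
  \<open>sqrt (w F')\<close>, and reading off the value at F divides by \<open>sqrt (w F)\<close>.
  This is the origin of the prefactor of the estimate.\<close>

lemma heat_kernel_eq:
  assumes B: "represents K w i (- B) (\<lambda>f E. - hodge_laplacian K w ori i f E)"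
    and F: "F \<in> faces K i" and F': "F' \<in> faces K i"
  shows "heat_kernel K w ori i t F F' =
    coord (app (exp (t *\<^sub>R (- B))) (unit F')) F / (sqrt (w F) * sqrt (w F'))"
proof -
  define f where "f E = 1 / w F' * (if E = F' then 1 else 0)" for E
  note pos = weight_pos[OF weighted F] weight_pos[OF weighted F']
  have "cochain_of K w i ((1 / sqrt (w F')) *\<^sub>R unit F') = f"
    using pos F' by (auto simp: f_def cochain_of_def coord_unit fun_eq_iff)
  moreover have "(1 / sqrt (w F')) *\<^sub>R unit F' \<in> supported (faces K i)"
    using F' by (auto simp: supported_def coord_unit)
  ultimately have f: "f \<in> l2 K w i" "ell2_of w f = (1 / sqrt (w F')) *\<^sub>R unit F'"
    using cochain_of_in_l2[OF weighted] ell2_of_cochain_of[OF weighted] by metis+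
  have rep: "represents K w i (t *\<^sub>R (- B)) (\<lambda>f E. - t * hodge_laplacian K w ori i f E)"
    unfolding represents_def
  proof
    fix g assume g: "g \<in> l2 K w i"
    show "(\<lambda>E. - t * hodge_laplacian K w ori i g E) \<in> l2 K w i \<and>
        ell2_of w (\<lambda>E. - t * hodge_laplacian K w ori i g E) = app (t *\<^sub>R (- B)) (ell2_of w g)"
      using l2_scale[OF weighted representsD(1)[OF B g], of t] representsD(2)[OF B g]
      by (simp add: app.scaleR_left app.minus_left)
  qed
  have "heat_kernel K w ori i t F F' = l2_exp K w i (\<lambda>f E. - t * hodge_laplacian K w ori i f E) f F"
    by (simp add: heat_kernel_def f_def[abs_def])
  also have "\<dots> = coord (ell2_of w (l2_exp K w i (\<lambda>f E. - t * hodge_laplacian K w ori i f E) f)) F / sqrt (w F)"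
    using pos coord_ell2_of[OF weighted l2_exp_ell2_of(1)[OF weighted rep f(1)], of F] by simp
  finally show ?thesis
    using l2_exp_ell2_of(2)[OF weighted rep f(1)] by (simp add: f(2) app.scaleR_right)
qed

end

section \<open>The heat kernel estimate\<close>

text \<open>Compare power series: the constant terms cancel, and every remaining even exponent n is
  at least 2, so \<tau> ^ n is at most \<tau> ^ 2.\<close>

lemma cosh_mult_minus_1_le:
  fixes a :: real
  assumes "0 \<le> \<tau>" "\<tau> \<le> 1"
  shows "cosh (\<tau> * a) - 1 \<le> \<tau>\<^sup>2 * (cosh a - 1)"
proof -
  have s: "(\<lambda>n. (if even n then x ^ n /\<^sub>R fact n else 0) - (if n = 0 then 1 else 0)) sums (cosh x - 1)" for x :: real
    using sums_diff[OF cosh_converges[of x] sums_single[of 0 "\<lambda>_. 1"]] by simp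
  show ?thesis
  proof (rule sums_le[OF _ s sums_mult[OF s]])
    fix n :: nat
    have "\<tau> ^ n \<le> \<tau>\<^sup>2" if "n \<ge> 2" using that assms by (intro power_decreasing)
    moreover have "0 \<le> a ^ n" if "even n" using that by (rule zero_le_even_power)
    ultimately have "n \<ge> 2 \<Longrightarrow> even n \<Longrightarrow> \<tau> ^ n * a ^ n / fact n \<le> \<tau>\<^sup>2 * a ^ n / fact n"
      by (intro divide_right_mono mult_right_mono) auto
    moreover have "n = 0 \<or> odd n \<or> n \<ge> 2 \<and> even n" by presburger
    ultimately show "(if even n then (\<tau> * a) ^ n /\<^sub>R fact n else 0) - (if n = 0 then 1 else 0)
        \<le> \<tau>\<^sup>2 * ((if even n then a ^ n /\<^sub>R fact n else 0) - (if n = 0 then 1 else 0))"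
      by (auto simp: power_mult_distrib divide_inverse mult_ac dest: odd_pos)
  qed
qed

text \<open>Davies' method needs a lower bound of the form on the whole space, so the operator is replaced by
  the scalar \<open>lam\<close> on the orthogonal complement of \<open>supported X\<close>.\<close>

lemma extend_form_bound:
  fixes A :: "'b ell2 blop"
  assumes A: "\<And>x. app A x \<in> supported X" and sym: "\<And>x y. app A x \<bullet> y = x \<bullet> app A y"
    and lower: "\<And>x. x \<in> supported X \<Longrightarrow> lam * (norm x)\<^sup>2 \<le> app A x \<bullet> x"
  obtains B where "\<And>x. x \<in> supported X \<Longrightarrow> app B x = app A x"
    and "\<And>x y. app B x \<bullet> y = x \<bullet> app B y"
    and "\<And>x. lam * (norm x)\<^sup>2 \<le> app B x \<bullet> x"
    and "\<And>x y. y \<in> X \<Longrightarrow> x \<noteq> y \<Longrightarrow> coord (app B (unit x)) y = coord (app A (unit x)) y"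
    and "\<And>x y. y \<notin> X \<Longrightarrow> x \<noteq> y \<Longrightarrow> coord (app B (unit x)) y = 0"
proof
  define P where "P = multiplier (\<lambda>x. if x \<in> X then 1 else 0 :: real)"
  have cP: "coord (app P x) y = (if y \<in> X then coord x y else 0)" for x y
    unfolding P_def by (subst coord_multiplier[where C = 1]) auto
  have P: "app P x \<in> supported X" for x by (simp add: supported_def cP)
  have orth: "(x - app P x) \<bullet> y = 0" if "y \<in> supported X" for x y
  proof -
    have "coord (x - app P x) z * coord y z = 0" for z using that by (simp add: cP supported_def)
    then show ?thesis unfolding inner_ell2.rep_eq by (intro infsum_0)
  qed
  have P_sym: "app P x \<bullet> y = x \<bullet> app P y" for x y
    using orth[OF P[of y], of x] orth[OF P[of x], of y]
    by (simp add: inner_diff_left inner_diff_right inner_commute)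
  \<comment> \<open>By symmetry the squared norm of A (x - P x) is an inner product of x - P x with
    a vector in the range of \<open>A\<close>, hence 0.\<close>
  have AP: "app A (app P x) = app A x" for x
  proof -
    have "app A (x - app P x) \<bullet> app A (x - app P x) = 0"
      unfolding sym by (rule orth) (rule A)
    then show ?thesis by (simp add: app.diff_right)
  qed
  \<comment> \<open>Off the cochains \<open>B\<close> is the scalar \<open>lam\<close>, which meets
    the lower bound with equality and adds nothing off the diagonal.\<close>
  define B where "B = A + lam *\<^sub>R (1 - P)"
  have B: "app B x = app A x + lam *\<^sub>R (x - app P x)" for x
    by (simp add: B_def app.add_left app.diff_left app.scaleR_left)
  show "app B x = app A x" if "x \<in> supported X" for x
  proof -
    have "app P x = x" using that by (intro ell2_eqI) (simp add: cP supported_def)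
    then show ?thesis by (simp add: B)
  qed
  show "app B x \<bullet> y = x \<bullet> app B y" for x y
    by (simp add: B inner_add_left inner_add_right inner_diff_left inner_diff_right sym P_sym)
  show "lam * (norm x)\<^sup>2 \<le> app B x \<bullet> x" for x
  proof -
    have "app A x \<bullet> x = app A (app P x) \<bullet> app P x" by (metis AP sym)
    moreover have "lam * (norm (app P x))\<^sup>2 \<le> app A (app P x) \<bullet> app P x" by (rule lower[OF P])
    moreover have "(norm (app P x))\<^sup>2 = app P x \<bullet> x"
      using orth[OF P[of x], of x] by (simp add: power2_norm_eq_inner inner_diff_left inner_diff_right inner_commute)
    ultimately show ?thesis
      by (simp add: B inner_add_left inner_diff_left power2_norm_eq_inner right_diff_distrib)
  qed
  show "coord (app B (unit x)) y = coord (app A (unit x)) y" if "y \<in> X" "x \<noteq> y" for x y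
    using that by (simp add: B cP coord_unit)
  show "coord (app B (unit x)) y = 0" if "y \<notin> X" "x \<noteq> y" for x y
    using that A[of "unit x"] by (simp add: B cP coord_unit supported_def)
qed

text \<open>Passes from the extended to the real intrinsic bound. Infinite distances may occur only
  next to a zero coefficient, where the value 0 that \<open>enn2real\<close> gives to infinity does
  no harm.\<close>

lemma intrinsic_metric_sum_le:
  assumes intrinsic: "intrinsic_metric K w i \<rho>" and F: "F \<in> faces K i" and w: "0 \<le> w F"
    and S: "finite S" "S \<subseteq> faces K i"
    and nonneg: "\<And>F'. F' \<in> S \<Longrightarrow> 0 \<le> w_pair K w i F F'"
    and fin: "\<And>F'. F' \<in> S \<Longrightarrow> w_pair K w i F F' \<noteq> 0 \<Longrightarrow> \<rho> F F' < \<infinity>"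
  shows "(\<Sum>F'\<in>S. w_pair K w i F F' * (enn2real (\<rho> F F'))\<^sup>2) \<le> w F"
proof -
  have "ennreal (\<Sum>F'\<in>S. w_pair K w i F F' * (enn2real (\<rho> F F'))\<^sup>2)
      = (\<Sum>F'\<in>S. ennreal (w_pair K w i F F' * (enn2real (\<rho> F F'))\<^sup>2))"
    using nonneg by (intro sum_ennreal[symmetric]) simp
  also have "\<dots> = (\<Sum>F'\<in>S. ennreal (w_pair K w i F F') * (\<rho> F F')\<^sup>2)"
  proof (rule sum.cong[OF refl])
    fix F' assume F': "F' \<in> S"
    show "ennreal (w_pair K w i F F' * (enn2real (\<rho> F F'))\<^sup>2) = ennreal (w_pair K w i F F') * (\<rho> F F')\<^sup>2"
    proof (cases "w_pair K w i F F' = 0")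
      case False
      then have "\<rho> F F' = ennreal (enn2real (\<rho> F F'))" using fin[OF F'] by simp
      then have "(\<rho> F F')\<^sup>2 = ennreal ((enn2real (\<rho> F F'))\<^sup>2)" by (metis ennreal_power enn2real_nonneg)
      then show ?thesis using nonneg[OF F'] by (simp add: ennreal_mult)
    qed simp
  qed
  also have "\<dots> \<le> (\<Sum>\<^sub>\<infinity>F'\<in>faces K i. ennreal (w_pair K w i F F') * (\<rho> F F')\<^sup>2)"
    by (subst nonneg_infsum_complete) (auto intro!: SUP_upper S)
  also have "\<dots> \<le> ennreal (w F)"
    using intrinsic F by (auto simp: intrinsic_metric_def)
  finally show ?thesis using w by simp
qed

text \<open>Cutting off at \<open>R\<close> keeps the Lipschitz estimate from the triangle
  inequality and yields real values even at points infinitely far from z.\<close>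

lemma truncated_metric_lipschitz:
  fixes \<rho> :: "'b \<Rightarrow> 'b \<Rightarrow> ennreal"
  assumes "pseudo_metric_on X \<rho>" and "x \<in> X" "y \<in> X" "z \<in> X" and "\<rho> x y < \<infinity>"
  shows "\<bar>enn2real (min (\<rho> z x) (ennreal R)) - enn2real (min (\<rho> z y) (ennreal R))\<bar> \<le> enn2real (\<rho> x y)"
proof -
  have le: "enn2real (min (\<rho> z b) (ennreal R)) \<le> enn2real (min (\<rho> z a) (ennreal R)) + enn2real (\<rho> x y)"
    if "\<rho> z b \<le> \<rho> z a + \<rho> x y" for a b
  proof -
    have "min (\<rho> z b) (ennreal R) \<le> min (\<rho> z a) (ennreal R) + \<rho> x y"
    proof (cases "\<rho> z a \<le> ennreal R")
      case True
      then show ?thesis using that by (simp add: min_def) (meson linear order_trans)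
    next
      case False
      then show ?thesis by (simp add: min_def add_increasing2)
    qed
    moreover have fin: "min (\<rho> z a) (ennreal R) < \<infinity>" by (simp add: min_less_iff_disj)
    ultimately have "enn2real (min (\<rho> z b) (ennreal R)) \<le> enn2real (min (\<rho> z a) (ennreal R) + \<rho> x y)"
      using assms(5) by (intro enn2real_mono) simp_all
    also have "\<dots> = enn2real (min (\<rho> z a) (ennreal R)) + enn2real (\<rho> x y)"
      using fin assms(5) by (intro enn2real_plus) simp_all
    finally show ?thesis .
  qed
  have "\<rho> z y \<le> \<rho> z x + \<rho> x y" "\<rho> z x \<le> \<rho> z y + \<rho> x y"
    using assms(1-4) unfolding pseudo_metric_on_def by metis+
  from le[OF this(1)] le[OF this(2)] show ?thesis by linarith
qed

text \<open>\<theta> and \<open>R\<close> are left free: for a finite distance R equals it and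
  \<theta> is optimised, for an infinite one \<theta> is fixed and R grows.\<close>

lemma heat_kernel_le:
  fixes \<rho> :: "'a set \<Rightarrow> 'a set \<Rightarrow> ennreal"
  assumes complex: "abstract_complex V K" and weighted: "weighted_complex K w"
    and bounded: "hodge_laplacian_bounded K w ori i"
    and intrinsic: "intrinsic_metric K w i \<rho>" and s: "0 < s" "jump_size K w i \<rho> = ennreal s"
    and F: "F \<in> faces K i" and F': "F' \<in> faces K i" and "0 \<le> t" and "0 \<le> \<theta>" and "0 \<le> R"
    and R: "ennreal R \<le> \<rho> F F'"
  shows "\<bar>heat_kernel K w ori i t F F'\<bar> \<le>
    1 / sqrt (w F * w F') * exp (- spectral_bottom K w ori i * t + (cosh (\<theta> * s) - 1) / s\<^sup>2 * t - \<theta> * R)"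
proof -
  define X where "X = faces K i"
  define lam where "lam = spectral_bottom K w ori i"
  define L where "L = laplace_op K w ori i"
  define c where "c = (cosh (\<theta> * s) - 1) / s\<^sup>2"
  have c: "0 \<le> c" unfolding c_def using cosh_real_ge_1[of "\<theta> * s"] by simp
  have metric: "pseudo_metric_on X \<rho>" using intrinsic by (simp add: intrinsic_metric_def X_def)
  note L_supp = laplace_op_supported[OF weighted bounded, folded L_def X_def]
  note L_sym = laplace_op_sym[OF weighted bounded, folded L_def]
  have "lam * (norm x)\<^sup>2 \<le> app L x \<bullet> x" if "x \<in> supported X" for x
    unfolding lam_def spectral_bottom_def L_def
    by (rule Inf_spectrum_le_form[OF weighted laplace_op_represents[OF weighted bounded]
          laplace_op_supported[OF weighted bounded] laplace_op_sym[OF weighted bounded]])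
       (use F that in \<open>auto simp: X_def\<close>)
  from extend_form_bound[OF L_supp L_sym this]
  obtain B where B: "\<And>x. x \<in> supported X \<Longrightarrow> app B x = app L x"
    and B_sym: "\<And>x y. app B x \<bullet> y = x \<bullet> app B y" and B_lower: "\<And>x. lam * (norm x)\<^sup>2 \<le> app B x \<bullet> x"
    and B_in: "\<And>x y. y \<in> X \<Longrightarrow> x \<noteq> y \<Longrightarrow> coord (app B (unit x)) y = coord (app L (unit x)) y"
    and B_out: "\<And>x y. y \<notin> X \<Longrightarrow> x \<noteq> y \<Longrightarrow> coord (app B (unit x)) y = 0"
    by blast
  have rep: "represents K w i (- B) (\<lambda>f E. - hodge_laplacian K w ori i f E)"
    unfolding represents_def
  proof
    fix f assume f: "f \<in> l2 K w i"
    note Lf = representsD[OF laplace_op_represents[OF weighted bounded] f]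
    show "(\<lambda>E. - hodge_laplacian K w ori i f E) \<in> l2 K w i \<and>
        ell2_of w (\<lambda>E. - hodge_laplacian K w ori i f E) = app (- B) (ell2_of w f)"
      using l2_scale[OF weighted Lf(1), of "- 1"] Lf(2) B[OF ell2_of_in_supported[OF weighted f, folded X_def]]
      by (simp add: L_def app.minus_left)
  qed
  have B_coord: "coord (app B (unit x)) y = coord (app B (unit y)) x" for x y
    using B_sym[of "unit x" "unit y"] by simp
  \<comment> \<open>The factor r y / r x turns the normalised entry bound w_pair / (r x * r y) into
    w_pair / w x, the form in which the intrinsic condition can be summed. The value 1 off the faces
    only keeps \<open>r\<close> positive.\<close>
  define r where "r x = (if x \<in> X then sqrt (w x) else 1)" for x
  have w: "0 < w x" if "x \<in> X" for x using weight_pos[OF weighted] that by (simp add: X_def)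
  have r: "0 < r x" for x using w by (simp add: r_def)
  \<comment> \<open>Measured from F', where the heat flow starts, so that the twist is trivial there
    and equals \<theta> R at F.\<close>
  define \<psi> where "\<psi> x = (if x \<in> X then \<theta> * enn2real (min (\<rho> F' x) (ennreal R)) else 0)" for x
  have "\<bar>\<psi> x\<bar> \<le> \<theta> * R" for x
  proof -
    have "enn2real (min (\<rho> F' x) (ennreal R)) \<le> R" using \<open>0 \<le> R\<close> by (intro enn2real_leI) auto
    then show ?thesis using \<open>0 \<le> \<theta>\<close> \<open>0 \<le> R\<close> by (simp add: \<psi>_def mult_left_mono)
  qed
  note \<psi>_bounded = this
  have jump: "\<rho> x y \<le> ennreal s" if "x \<in> X" "y \<in> X" "w_pair K w i x y \<noteq> 0" for x y
  proof -
    have xy: "(x, y) \<in> adjacent_pairs K w i" using that by (simp add: adjacent_pairs_def X_def)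
    then have "jump_size K w i \<rho> = (SUP (F, F')\<in>adjacent_pairs K w i. \<rho> F F')"
      by (auto simp: jump_size_def)
    moreover have "\<rho> x y \<le> (SUP (F, F')\<in>adjacent_pairs K w i. \<rho> F F')"
      using SUP_upper[OF xy, of "\<lambda>(F, F'). \<rho> F F'"] by simp
    ultimately show ?thesis using s(2) by simp
  qed
  have twist: "cosh (\<psi> x - \<psi> y) - 1 \<le> c * (enn2real (\<rho> x y))\<^sup>2"
    if xy: "x \<in> X" "y \<in> X" "w_pair K w i x y \<noteq> 0" for x y
  proof -
    define d where "d = enn2real (\<rho> x y)"
    have fin: "\<rho> x y < \<infinity>" using jump[OF xy] by (simp add: le_less_trans)
    have d: "0 \<le> d" "d \<le> s" unfolding d_def using jump[OF xy] s(1) by (auto intro: enn2real_leI)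
    have "\<psi> x - \<psi> y = \<theta> * (enn2real (min (\<rho> F' x) (ennreal R)) - enn2real (min (\<rho> F' y) (ennreal R)))"
      using xy by (simp add: \<psi>_def right_diff_distrib)
    then have "\<bar>\<psi> x - \<psi> y\<bar> \<le> \<theta> * d"
      using truncated_metric_lipschitz[OF metric xy(1,2) _ fin, of F' R] F' \<open>0 \<le> \<theta>\<close>
      by (simp add: abs_mult mult_left_mono d_def X_def)
    then have "cosh \<bar>\<psi> x - \<psi> y\<bar> \<le> cosh (\<theta> * d)"
      using \<open>0 \<le> \<theta>\<close> d(1) by (subst cosh_real_nonneg_le_iff) auto
    \<comment> \<open>The argument \<theta> d is written as d / s times \<theta> s with d / s at
      most 1; the quadratic gain (d / s) ^ 2 supplies both the squared distance and the 1 / s ^ 2 in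
      \<open>c\<close>.\<close>
    then have "cosh (\<psi> x - \<psi> y) - 1 \<le> cosh ((d / s) * (\<theta> * s)) - 1"
      using s(1) by (simp add: mult.commute)
    also have "\<dots> \<le> (d / s)\<^sup>2 * (cosh (\<theta> * s) - 1)"
      using d s(1) by (intro cosh_mult_minus_1_le) auto
    finally show ?thesis by (simp add: c_def d_def power_divide mult.commute)
  qed
  have schur: "(\<Sum>y\<in>S. \<bar>coord (app B (unit x)) y\<bar> * (r y / r x) * (cosh (\<psi> x - \<psi> y) - 1)) \<le> c"
    if S: "finite S" for S x
  proof -
    define e where "e y = \<bar>coord (app B (unit x)) y\<bar> * (r y / r x) * (cosh (\<psi> x - \<psi> y) - 1)" for y
    \<comment> \<open>On the diagonal the factor cosh 0 - 1 vanishes; off the diagonal an index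
      outside the faces makes the entry of \<open>B\<close> zero, by symmetry for either
      index.\<close>
    have zero: "e y = 0" if "x \<notin> X \<or> y \<notin> X" for y
    proof (cases "x = y")
      case False
      then show ?thesis using that B_out[of y x] B_out[of x y] B_coord[of x y] by (auto simp: e_def)
    qed (simp add: e_def)
    show ?thesis
    proof (cases "x \<in> X")
      case False
      then have "sum e S = 0" using zero by (intro sum.neutral) auto
      then show ?thesis using c by (simp add: e_def)
    next
      case x: True
      have e_le: "e y \<le> c / w x * (w_pair K w i x y * (enn2real (\<rho> x y))\<^sup>2)" if y: "y \<in> X" for y
      proof (cases "x = y")
        case True
        then show ?thesis by (simp add: e_def w_pair_def)
      next
        case False
        have entry: "\<bar>coord (app B (unit x)) y\<bar> \<le> w_pair K w i x y / (r x * r y)"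
          using abs_laplace_op_entry_le[OF complex weighted bounded _ _ False] x y B_in[OF y False]
          by (simp add: L_def X_def r_def)
        have "\<bar>coord (app B (unit x)) y\<bar> * (r y / r x) \<le> w_pair K w i x y / (r x * r y) * (r y / r x)"
          using r[of x] r[of y] by (intro mult_right_mono[OF entry]) simp
        also have "\<dots> = w_pair K w i x y / w x"
          using r[of y] w[OF x] x by (simp add: r_def)
        finally have "e y \<le> w_pair K w i x y / w x * (cosh (\<psi> x - \<psi> y) - 1)"
          unfolding e_def using cosh_real_ge_1[of "\<psi> x - \<psi> y"] by (intro mult_right_mono) auto
        \<comment> \<open>\<open>twist\<close> is available for adjacent faces only; for all others
          both sides carry the factor 0.\<close>
        also have "\<dots> \<le> w_pair K w i x y / w x * (c * (enn2real (\<rho> x y))\<^sup>2)"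
          using twist[OF x y] w_pair_nonneg[OF complex weighted, of x i y] x y w[OF x]
          by (cases "w_pair K w i x y = 0") (auto intro!: mult_left_mono divide_right_mono simp: X_def)
        finally show ?thesis by (simp add: mult.commute mult.left_commute)
      qed
      have "sum e S = sum e (S \<inter> X)"
        using zero S by (intro sum.mono_neutral_right) auto
      also have "\<dots> \<le> (\<Sum>y\<in>S \<inter> X. c / w x * (w_pair K w i x y * (enn2real (\<rho> x y))\<^sup>2))"
        using e_le by (intro sum_mono) simp
      also have "\<dots> = c / w x * (\<Sum>y\<in>S \<inter> X. w_pair K w i x y * (enn2real (\<rho> x y))\<^sup>2)"
        by (simp add: sum_distrib_left)
      also have "\<dots> \<le> c / w x * w x"
      proof (intro mult_left_mono intrinsic_metric_sum_le[OF intrinsic])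
        show "0 \<le> w_pair K w i x y" if "y \<in> S \<inter> X" for y
          using that x w_pair_nonneg[OF complex weighted, of x i y] by (simp add: X_def)
        show "\<rho> x y < \<infinity>" if "y \<in> S \<inter> X" "w_pair K w i x y \<noteq> 0" for y
          using that x jump[of x y] by (simp add: le_less_trans)
      qed (use x c S w[OF x] in \<open>auto simp: X_def\<close>)
      finally show ?thesis using w[OF x] by (simp add: e_def)
    qed
  qed
  have "\<rho> F' F = \<rho> F F'" "\<rho> F' F' = 0"
    using metric F F' unfolding pseudo_metric_on_def X_def by blast+
  then have \<psi>: "\<psi> F = \<theta> * R" "\<psi> F' = 0"
    using F F' R \<open>0 \<le> R\<close> by (auto simp: \<psi>_def X_def min_def)
  have "\<bar>coord (app (exp (t *\<^sub>R (- B))) (unit F')) F\<bar> \<le> exp (- lam * t + c * t + \<psi> F' - \<psi> F)"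
    by (rule davies_estimate[OF B_coord B_lower \<psi>_bounded r schur \<open>0 \<le> t\<close>])
  then have "\<bar>coord (app (exp (t *\<^sub>R (- B))) (unit F')) F\<bar> / (sqrt (w F) * sqrt (w F'))
      \<le> exp (- lam * t + c * t - \<theta> * R) / (sqrt (w F) * sqrt (w F'))"
    using w F F' by (intro divide_right_mono) (auto simp: \<psi> X_def intro: less_imp_le)
  then show ?thesis
    using w[of F] w[of F'] F F' unfolding heat_kernel_eq[OF complex weighted rep F F']
    by (simp add: lam_def c_def real_sqrt_mult X_def abs_mult)
qed

text \<open>The choice \<open>\<theta> = arsinh (r s / t) / s\<close> minimises the exponent.\<close>

lemma zeta_real_eq:
  assumes "0 < s" "0 < t"
  shows "(cosh (arsinh (r * s / t) / s * s) - 1) / s\<^sup>2 * t - arsinh (r * s / t) / s * r = - zeta_real s t r"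
proof -
  have "t * cosh (arsinh (r * s / t)) = sqrt (t\<^sup>2 + r\<^sup>2 * s\<^sup>2)"
  proof -
    have "t * sqrt ((r * s / t)\<^sup>2 + 1) = sqrt (t\<^sup>2 * ((r * s / t)\<^sup>2 + 1))"
      using assms by (simp add: real_sqrt_mult)
    also have "t\<^sup>2 * ((r * s / t)\<^sup>2 + 1) = t\<^sup>2 + r\<^sup>2 * s\<^sup>2"
      using assms by (simp add: power_divide power_mult_distrib field_simps)
    finally show ?thesis by (simp add: cosh_arsinh_real)
  qed
  then have zeta: "zeta_real s t r =
      1 / s\<^sup>2 * (r * s * arsinh (r * s / t) - t * cosh (arsinh (r * s / t)) + t)"
    by (simp add: zeta_real_def)
  show ?thesis unfolding zeta using assms by (simp add: field_simps power2_eq_square)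
qed

theorem mainTheorem2:
  fixes V :: "'a set" and K :: "'a set set" and w :: "'a set \<Rightarrow> real"
    and ori :: "'a set \<Rightarrow> 'a list set" and i :: int
    and \<rho> :: "'a set \<Rightarrow> 'a set \<Rightarrow> ennreal" and s lam t :: real and F F' :: "'a set"
  assumes "abstract_complex V K" and "weighted_complex K w" and "oriented_complex K ori"
    and "0 \<le> i" and "ereal (real_of_int i) \<le> dim_of_complex K"
    and "hodge_laplacian_bounded K w ori i"
    and "intrinsic_metric K w i \<rho>"
    and "0 < s" and "jump_size K w i \<rho> = ennreal s"
    and "lam = spectral_bottom K w ori i"
    and "F \<in> faces K i" and "F' \<in> faces K i" and "0 < t"
  shows "ereal \<bar>heat_kernel K w ori i t F F'\<bar>
           \<le> ereal (1 / sqrt (w F * w F')) * exp_ereal (ereal (- lam * t) - zeta s t (\<rho> F F'))"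
proof -
  have bound: "\<bar>heat_kernel K w ori i t F F'\<bar>
      \<le> 1 / sqrt (w F * w F') * exp (- lam * t + (cosh (\<theta> * s) - 1) / s\<^sup>2 * t - \<theta> * R)"
    if "0 \<le> \<theta>" "0 \<le> R" "ennreal R \<le> \<rho> F F'" for \<theta> R
    using heat_kernel_le[OF assms(1,2,6-9,11,12) less_imp_le[OF \<open>0 < t\<close>] that] assms(10) by simp
  show ?thesis
  proof (cases "\<rho> F F' = \<infinity>")
    case True
    \<comment> \<open>With \<theta> = 1 and every natural number admissible as \<open>R\<close>, the
      bound is C exp (-n) for all n, so the kernel vanishes.\<close>
    define C where "C = 1 / sqrt (w F * w F') * exp (- lam * t + (cosh s - 1) / s\<^sup>2 * t)"
    have "\<bar>heat_kernel K w ori i t F F'\<bar> \<le> C * exp (- real n)" for n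
      using bound[of 1 "real n"] True by (simp add: C_def exp_diff exp_minus divide_inverse)
    moreover have "(\<lambda>n. C * exp (- real n)) \<longlonglongrightarrow> C * 0"
      by (intro tendsto_mult tendsto_const) real_asymp
    ultimately have "\<bar>heat_kernel K w ori i t F F'\<bar> \<le> 0"
      by (intro LIMSEQ_le_const[of _ "0"]) auto
    then show ?thesis using True by (simp add: zeta_def exp_ereal_def)
  next
    case False
    define r where "r = enn2real (\<rho> F F')"
    have r: "0 \<le> r" "ennreal r \<le> \<rho> F F'" using False by (auto simp: r_def less_top)
    \<comment> \<open>The root of the derivative t sinh (\<theta> s) / s - r of the exponent with
      respect to \<theta>, with the cutoff at the full distance r.\<close>
    define \<theta> where "\<theta> = arsinh (r * s / t) / s"
    have "0 \<le> r * s / t" using r \<open>0 < s\<close> \<open>0 < t\<close> by simp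
    then have "0 \<le> arsinh (r * s / t)" using arsinh_real_neg_iff[of "r * s / t"] by linarith
    then have "0 \<le> \<theta>" using \<open>0 < s\<close> by (simp add: \<theta>_def)
    have e: "- lam * t + (cosh (\<theta> * s) - 1) / s\<^sup>2 * t - \<theta> * r = - lam * t - zeta_real s t r"
      using zeta_real_eq[OF \<open>0 < s\<close> \<open>0 < t\<close>, of r] unfolding \<theta>_def by linarith
    show ?thesis
      using bound[OF \<open>0 \<le> \<theta>\<close> r, unfolded e] False by (simp add: zeta_def exp_ereal_def r_def)
  qed
qed

end
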